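(* Let $X$ be a source with finite alphabet and distribution $P_X$, let $d(x^n,x'^n)=\frac1n\sum_{i=1}^n d_{\mathrm{sym}}(x_i,x'_i)$ be a symbolwise distortion function with $0\le d_{\mathrm{sym}}\le1$, where the reconstruction symbols $x'$ are binary, and let $\bar d\le1$. Let $P_{XX'}$ be the optimal joint distribution in the rate-distortion function at $\bar d$, and suppose that the induced channel $W=P_{X|X'}$ (from $X'$ to $X$) is symmetric. Let $W^\perp$ be the dual channel of $W$. Then a linear $(k,\varepsilon)$ code $C$ of blocklength $n$ for $W^\perp$ can be used to construct an $(n-k,\ \bar d+\sqrt{2\varepsilon})$ lossy compression scheme for $X^n\sim P_X^{\times n}$.
   Context: Logarithms are to base 2, and $P^{\times n}$ is the $n$-fold i.i.d. product. Rate-distortion function: $R(\bar d)=\inf I(X{:}X')$, the infimum of the mutual information over joint distributions $P_{XX'}$ with $X$-marginal $P_X$ (equivalently, over channels from $X$ to $X'$) satisfying $\mathbb E_{P_{XX'}}d_{\mathrm{sym}}(X,X')\le\bar d$; the optimal $P_{XX'}$ is one attaining it. Symmetric channel: a binary-input channel $W$ is symmetric if there is an involutive permutation $\pi$ of the output alphabet with $W(\pi(x)\,|\,x'+1)=W(x\,|\,x')$ for all $x$ and all $x'\in\{0,1\}$ (addition mod 2). Dual channel: regard $W$ as taking $z\in\{0,1\}$ to the diagonal density operator $\varphi_z=\sum_x W(x|z)|x\rangle\langle x|$ on a system $B$. Choose purifications $|\varphi_z\rangle_{BD}$ of $\varphi_z$, let $A$ be a qubit with orthonormal basis $\{|0\rangle,|1\rangle\}$,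 and for $u\in\{0,1\}$ set $|\theta_u\rangle_{ABD}=\frac1{\sqrt2}\sum_{z}(-1)^{uz}|z\rangle_A|\varphi_z\rangle_{BD}$. The dual channel $W^\perp$ has classical input $u$ and quantum output the density operator $\mathrm{Tr}_B|\theta_u\rangle\langle\theta_u|$ on $AD$. (For instance, the dual of the binary symmetric channel with crossover probability $\delta$ is, up to an invertible output transformation, the channel with pure-state outputs $\sqrt\delta|0\rangle+(-1)^u\sqrt{1-\delta}|1\rangle$.) A linear $(k,\varepsilon)$ code $C$ of blocklength $n$ for $W^\perp$ is a linear subspace $C\subseteq\mathbb F_2^n$ with $\log|C|=k$ such that, when a uniformly random codeword is sent through $n$ uses of $W^\perp$, the optimal decoder (measurement on the output) has average error probability $\varepsilon$. Lossy compression (average distortion): an $(m,D_0)$ lossy compression scheme for $X^n$ consists of an encoder $E$ from the alphabet of $X^n$ to a finite set $\mathcal C$ with $\log|\mathcal C|=m$ and a decoder $D$ from $\mathcal C$ to the alphabet of $X'^n$ such that $\mathbb E\,d(X^n,D(E(X^n)))\le D_0$. *)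

theory Defs
  imports "HOL-Probability.Probability" "HOL-Library.Z2"
begin

instance bit :: finite
proof
  have "(UNIV :: bit set) \<subseteq> {0, 1}"
    by (auto intro: bit_not_one_iff[THEN iffD1])
  then show "finite (UNIV :: bit set)"
    using finite_subset by blast
qed

definition mutual_info :: "('a \<times> 'b) pmf \<Rightarrow> real" where
  "mutual_info P =
     prob_space.mutual_information (measure_pmf P) 2 (count_space UNIV) (count_space UNIV) fst snd"

definition admissible_joint ::
  "'x pmf \<Rightarrow> ('x \<Rightarrow> 'y \<Rightarrow> real) \<Rightarrow> real \<Rightarrow> ('x \<times> 'y) pmf \<Rightarrow> bool" where
  "admissible_joint PX d \<delta> P \<longleftrightarrow>
     map_pmf fst P = PX \<and> measure_pmf.expectation P (\<lambda>(x, x'). d x x') \<le> \<delta>"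

text \<open>The infimum is meaningful only if some joint distribution is admissible; this is guaranteed
  wherever an optimal joint distribution is given.\<close>

definition rate_distortion :: "'x pmf \<Rightarrow> ('x \<Rightarrow> 'y \<Rightarrow> real) \<Rightarrow> real \<Rightarrow> real" where
  "rate_distortion PX d \<delta> = (INF P \<in> {P. admissible_joint PX d \<delta> P}. mutual_info P)"

definition optimal_joint ::
  "'x pmf \<Rightarrow> ('x \<Rightarrow> 'y \<Rightarrow> real) \<Rightarrow> real \<Rightarrow> ('x \<times> 'y) pmf \<Rightarrow> bool" where
  "optimal_joint PX d \<delta> P \<longleftrightarrow>
     admissible_joint PX d \<delta> P \<and> mutual_info P = rate_distortion PX d \<delta>"

text \<open>\<open>W = P\<^bsub>X|X'\<^esub>\<close>. If \<open>P\<^bsub>X'\<^esub>(x') > 0\<close>, this determines \<open>W x'\<close>; if \<open>P\<^bsub>X'\<^esub>(x') = 0\<close>, the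
  conditional distribution is arbitrary, and any choice of it is accepted.\<close>

definition induced_channel :: "('x \<times> 'y) pmf \<Rightarrow> ('y \<Rightarrow> 'x pmf) \<Rightarrow> bool" where
  "induced_channel P W \<longleftrightarrow>
     (\<forall>x x'. pmf P (x, x') = pmf (map_pmf snd P) x' * pmf (W x') x)"

definition symmetric_channel :: "(bit \<Rightarrow> 'x pmf) \<Rightarrow> bool" where
  "symmetric_channel W \<longleftrightarrow>
     (\<exists>\<pi>. bij \<pi> \<and> \<pi> \<circ> \<pi> = id \<and> (\<forall>x x'. pmf (W (x' + 1)) (\<pi> x) = pmf (W x') x))"

text \<open>The default value of \<^const>\<open>Pi_pmf\<close> is never used, as the index set is the whole type.\<close>

definition iid_source :: "'x pmf \<Rightarrow> ('n::finite \<Rightarrow> 'x) pmf" where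
  "iid_source PX = Pi_pmf UNIV undefined (\<lambda>_. PX)"

definition symbolwise_distortion ::
  "('x \<Rightarrow> 'y \<Rightarrow> real) \<Rightarrow> ('n::finite \<Rightarrow> 'x) \<Rightarrow> ('n \<Rightarrow> 'y) \<Rightarrow> real" where
  "symbolwise_distortion d x x' = (1 / real CARD('n)) * (\<Sum>i\<in>UNIV. d (x i) (x' i))"

definition lossy_compression_scheme ::
  "'a pmf \<Rightarrow> ('a \<Rightarrow> 'b \<Rightarrow> real) \<Rightarrow> real \<Rightarrow> real \<Rightarrow> 'c set \<Rightarrow> ('a \<Rightarrow> 'c) \<Rightarrow> ('c \<Rightarrow> 'b) \<Rightarrow> bool" where
  "lossy_compression_scheme P d m D\<^sub>0 M E D \<longleftrightarrow>
     finite M \<and> log 2 (real (card M)) = m \<and> range E \<subseteq> M \<and>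
     measure_pmf.expectation P (\<lambda>x. d x (D (E x))) \<le> D\<^sub>0"

text \<open>A system is a finite type labelling an orthonormal basis, a composite system is the product
  of these types, and operators are given by their matrices in these bases.\<close>

definition ketbra :: "complex ^ 'i \<Rightarrow> complex ^ 'i ^ 'i" where
  "ketbra v = (\<chi> i j. v $ i * cnj (v $ j))"

definition positive_op :: "complex ^ 'i ^ 'i \<Rightarrow> bool" where
  "positive_op A \<longleftrightarrow>
     (\<forall>i j. A $ j $ i = cnj (A $ i $ j)) \<and>
     (\<forall>v. 0 \<le> Re (\<Sum>i\<in>UNIV. \<Sum>j\<in>UNIV. cnj (v $ i) * A $ i $ j * v $ j))"

definition trace_snd :: "complex ^ ('b::finite \<times> 'd::finite) ^ ('b \<times> 'd) \<Rightarrow> complex ^ 'b ^ 'b" where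
  "trace_snd M = (\<chi> i j. \<Sum>k\<in>UNIV. M $ (i, k) $ (j, k))"

definition trace_mid ::
  "complex ^ ('a::finite \<times> 'b::finite \<times> 'd::finite) ^ ('a \<times> 'b \<times> 'd) \<Rightarrow> complex ^ ('a \<times> 'd) ^ ('a \<times> 'd)"
where
  "trace_mid M = (\<chi> i j. \<Sum>b\<in>UNIV. M $ (fst i, b, snd i) $ (fst j, b, snd j))"

definition tensor_op :: "('n::finite \<Rightarrow> complex ^ 'i::finite ^ 'i) \<Rightarrow> complex ^ ('n \<Rightarrow> 'i) ^ ('n \<Rightarrow> 'i)" where
  "tensor_op \<rho> = (\<chi> f g. \<Prod>i\<in>UNIV. \<rho> i $ f i $ g i)"

definition diag_state :: "'x::finite pmf \<Rightarrow> complex ^ 'x ^ 'x" where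
  "diag_state p = (\<chi> i j. if i = j then complex_of_real (pmf p i) else 0)"

definition purification :: "complex ^ ('b::finite \<times> 'd::finite) \<Rightarrow> complex ^ 'b ^ 'b \<Rightarrow> bool" where
  "purification \<psi> \<rho> \<longleftrightarrow> trace_snd (ketbra \<psi>) = \<rho>"

text \<open>The conditional is the sign \<open>(-1)\<^sup>u\<^sup>z\<close>.\<close>

definition theta_state ::
  "(bit \<Rightarrow> complex ^ ('b::finite \<times> 'd::finite)) \<Rightarrow> bit \<Rightarrow> complex ^ (bit \<times> 'b \<times> 'd)" where
  "theta_state \<phi> u =
     (\<chi> i. case i of (z, b, d) \<Rightarrow>
        complex_of_real (1 / sqrt 2) * (if u * z = 1 then - 1 else 1) * \<phi> z $ (b, d))"

text \<open>The dual channel depends on the chosen purifications; \<open>dual_channel W V\<close> holds if \<open>V\<close> arises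
  from some choice of them, with purifying system \<open>'d\<close>.\<close>

definition dual_channel ::
  "(bit \<Rightarrow> 'x::finite pmf) \<Rightarrow> (bit \<Rightarrow> complex ^ (bit \<times> 'd::finite) ^ (bit \<times> 'd)) \<Rightarrow> bool" where
  "dual_channel W V \<longleftrightarrow>
     (\<exists>\<phi> :: bit \<Rightarrow> complex ^ ('x \<times> 'd).
        (\<forall>z. purification (\<phi> z) (diag_state (W z))) \<and>
        (\<forall>u. V u = trace_mid (ketbra (theta_state \<phi> u))))"

definition povm :: "'c set \<Rightarrow> ('c \<Rightarrow> complex ^ 'i ^ 'i) \<Rightarrow> bool" where
  "povm C \<Lambda> \<longleftrightarrow> (\<forall>c\<in>C. positive_op (\<Lambda> c)) \<and> (\<Sum>c\<in>C. \<Lambda> c) = mat 1"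

definition block_output ::
  "(bit \<Rightarrow> complex ^ 'i::finite ^ 'i) \<Rightarrow> bit ^ 'n::finite \<Rightarrow> complex ^ ('n \<Rightarrow> 'i) ^ ('n \<Rightarrow> 'i)" where
  "block_output V c = tensor_op (\<lambda>i. V (c $ i))"

definition avg_error ::
  "(bit \<Rightarrow> complex ^ 'i::finite ^ 'i) \<Rightarrow> (bit ^ 'n::finite) set \<Rightarrow>
   (bit ^ 'n \<Rightarrow> complex ^ ('n \<Rightarrow> 'i) ^ ('n \<Rightarrow> 'i)) \<Rightarrow> real" where
  "avg_error V C \<Lambda> =
     1 - (1 / real (card C)) * (\<Sum>c\<in>C. Re (trace (\<Lambda> c ** block_output V c)))"

definition optimal_decoder ::
  "(bit \<Rightarrow> complex ^ 'i::finite ^ 'i) \<Rightarrow> (bit ^ 'n::finite) set \<Rightarrow>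
   (bit ^ 'n \<Rightarrow> complex ^ ('n \<Rightarrow> 'i) ^ ('n \<Rightarrow> 'i)) \<Rightarrow> bool" where
  "optimal_decoder V C \<Lambda> \<longleftrightarrow>
     povm C \<Lambda> \<and> (\<forall>\<Lambda>'. povm C \<Lambda>' \<longrightarrow> avg_error V C \<Lambda> \<le> avg_error V C \<Lambda>')"

definition linear_code ::
  "(bit \<Rightarrow> complex ^ 'i::finite ^ 'i) \<Rightarrow> real \<Rightarrow> real \<Rightarrow> (bit ^ 'n::finite) set \<Rightarrow> bool" where
  "linear_code V k \<epsilon> C \<longleftrightarrow>
     vec.subspace C \<and> log 2 (real (card C)) = k \<and>
     (\<exists>\<Lambda>. optimal_decoder V C \<Lambda> \<and> avg_error V C \<Lambda> = \<epsilon>)"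

end

theory Submission
  imports Defs
begin

text \<open>
  The codebook is a coset of the dual code \<open>C\<^sup>\<bottom>\<close>, which has \<open>2\<^sup>n\<^sup>-\<^sup>k\<close> elements, and a source word is
  encoded as its nearest codeword. A decoder for \<open>C\<close> on the dual channel distinguishes the characters
  of the group of cosets. It can do so with probability \<open>1 - \<epsilon>\<close> only if the vectors attached to the
  cosets have nearly equal norms, which says that a uniformly random element of a coset, sent through
  \<open>W\<close>, has on average nearly the same output distribution as a uniformly random word. Hence sampling
  from the posterior of the uniform input restricted to a random coset costs at most \<open>\<surd>\<epsilon>\<close> more
  distortion than sampling from the unrestricted posterior.

  The optimal \<open>P\<^bsub>X'\<^esub>\<close> need not be uniform, so two things remain. The source may be replaced by the
  output distribution of the uniform input, because flipping the letters with the involution of the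
  channel permutes the cosets. And the posterior for the uniform prior has distortion at most that
  of the optimal joint distribution: otherwise a first-order variation would improve the latter.
\<close>

section \<open>Binary vectors and cosets of the dual code\<close>

text \<open>Otherwise the simplifier turns the field operations of \<open>bit\<close> into bitwise
  ones, out of reach of the ring laws.\<close>

declare add_bit_eq_xor [simp del] mult_bit_eq_and [simp del]

lemma UNIV_bit: "(UNIV :: bit set) = {0, 1}"
  by (auto intro: bit_not_one_iff[THEN iffD1])

lemma sum_fun_prod:
  fixes g :: "'n::finite \<Rightarrow> 'a::finite \<Rightarrow> 'b::comm_semiring_1"
  shows "(\<Sum>f\<in>UNIV. \<Prod>i\<in>UNIV. g i (f i)) = (\<Prod>i\<in>UNIV. \<Sum>a\<in>UNIV. g i a)"
  using prod_sum_PiE[of "UNIV :: 'n set" "\<lambda>_. UNIV :: 'a set" g] by simp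

lemma sum_fun_pair:
  fixes G :: "('n::finite \<Rightarrow> 'a::finite) \<Rightarrow> ('n \<Rightarrow> 'b::finite) \<Rightarrow> 'c::comm_monoid_add"
  shows "(\<Sum>f\<in>UNIV. G (fst \<circ> f) (snd \<circ> f)) = (\<Sum>a\<in>UNIV. \<Sum>b\<in>UNIV. G a b)"
proof -
  have "(\<Sum>a\<in>UNIV. \<Sum>b\<in>UNIV. G a b) = (\<Sum>p\<in>UNIV. G (fst p) (snd p))"
    by (simp add: sum.cartesian_product case_prod_beta)
  also have "\<dots> = (\<Sum>f\<in>UNIV. G (fst \<circ> f) (snd \<circ> f))"
    by (rule sum.reindex_bij_witness[of _ "\<lambda>f. (fst \<circ> f, snd \<circ> f)" "\<lambda>p i. (fst p i, snd p i)"])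
      (auto simp: comp_def)
  finally show ?thesis ..
qed

text \<open>The nontrivial additive character of the field of two elements. It serves as a real
  scalar and as a complex factor, hence the general ring.\<close>

definition bsign :: "bit \<Rightarrow> 'a::comm_ring_1" where
  "bsign u = (if u = 1 then - 1 else 1)"

lemma bsign_simps [simp]: "bsign 0 = 1" "bsign 1 = - 1"
  by (simp_all add: bsign_def)

lemma bsign_add: "bsign (u + v) = bsign u * bsign v"
  by (cases u; cases v) auto

lemma bsign_sum: "bsign (sum f A) = (\<Prod>i\<in>A. bsign (f i))"
  by (induction A rule: infinite_finite_induct) (simp_all add: bsign_add)

text \<open>Code words are vectors as in \<open>linear_code\<close>; input words are functions
  because they label the basis of a tensor power.\<close>

definition bdot :: "bit ^ 'n::finite \<Rightarrow> ('n \<Rightarrow> bit) \<Rightarrow> bit" where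
  "bdot c z = (\<Sum>i\<in>UNIV. c $ i * z i)"

text \<open>The coset of \<open>t\<close> modulo the dual code of \<open>C\<close>. Cosets are
  indexed by all their representatives instead of a quotient; each one occurs as often as it has
  elements.\<close>

definition dual_coset :: "(bit ^ 'n::finite) set \<Rightarrow> ('n \<Rightarrow> bit) \<Rightarrow> ('n \<Rightarrow> bit) set" where
  "dual_coset C t = {z. \<forall>c\<in>C. bdot c z = bdot c t}"

definition bit_shift :: "('n \<Rightarrow> bit) \<Rightarrow> ('n \<Rightarrow> bit) \<Rightarrow> 'n \<Rightarrow> bit" where
  "bit_shift u z = (\<lambda>i. z i + u i)"

lemma bit_add_cancel [simp]: "(a::bit) + b + b = a"
  by (cases a; cases b) auto

lemma bit_shift_shift [simp]: "bit_shift u (bit_shift u z) = z"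
  by (simp add: bit_shift_def)

lemma bit_shift_0 [simp]: "bit_shift u (\<lambda>_. 0) = u"
  by (simp add: bit_shift_def)

lemma bij_shift: "bij (bit_shift u)"
  by (rule o_bij[of "bit_shift u"]) (auto simp: comp_def)

lemma sum_shift: "(\<Sum>z\<in>UNIV. f (bit_shift u z)) = (\<Sum>z\<in>UNIV. f z)"
  using sum.reindex_bij_betw[OF bij_shift] by metis

lemma bdot_shift: "bdot c (bit_shift u z) = bdot c z + bdot c u"
  by (simp add: bdot_def bit_shift_def algebra_simps sum.distrib)

lemma mem_dual_coset_self [simp]: "t \<in> dual_coset C t"
  by (simp add: dual_coset_def)

lemma mem_dual_coset_commute: "z \<in> dual_coset C t \<longleftrightarrow> t \<in> dual_coset C z"
  by (auto simp: dual_coset_def)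

lemma bit_shift_mem_dual_coset_iff: "bit_shift u z \<in> dual_coset C (bit_shift u t) \<longleftrightarrow> z \<in> dual_coset C t"
  by (simp add: dual_coset_def bdot_shift)

lemma bij_betw_shift_dual_coset: "bij_betw (bit_shift u) (dual_coset C t) (dual_coset C (bit_shift u t))"
  by (rule bij_betw_byWitness[of _ "bit_shift u"])
    (auto simp: bit_shift_mem_dual_coset_iff, metis bit_shift_mem_dual_coset_iff bit_shift_shift)

lemma card_dual_coset: "card (dual_coset C t) = card (dual_coset C (\<lambda>_. 0))"
  using bij_betw_same_card[OF bij_betw_shift_dual_coset[of t C "\<lambda>_. 0"]] by simp

text \<open>Orthogonality of characters: translation by a code word \<open>c0\<close> with
  \<open>bdot c0 z = 1\<close> negates the sum.\<close>

lemma sum_bsign_bdot_code: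
  assumes "vec.subspace C"
  shows "(\<Sum>c\<in>C. bsign (bdot c z)) =
    (if z \<in> dual_coset C (\<lambda>_. 0) then of_nat (card C) else (0::real))"
proof (cases "z \<in> dual_coset C (\<lambda>_. 0)")
  case True
  then have "bsign (bdot c z) = (1::real)" if "c \<in> C" for c
    using that by (simp add: dual_coset_def bdot_def)
  then show ?thesis using True by simp
next
  case False
  then obtain c0 where c0: "c0 \<in> C" "bdot c0 z = 1"
    by (auto simp: dual_coset_def bdot_def)
  have add: "c + c0 \<in> C" if "c \<in> C" for c
    using assms c0 that by (simp add: vec.subspace_add)
  have canc: "c + c0 + c0 = c" for c
    by (simp add: vec_eq_iff)
  have "(\<Sum>c\<in>C. bsign (bdot c z)) = (\<Sum>c\<in>C. bsign (bdot (c + c0) z) :: real)"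
    by (rule sum.reindex_bij_witness[of _ "\<lambda>c. c + c0" "\<lambda>c. c + c0"]) (auto simp: add canc)
  also have "\<dots> = (\<Sum>c\<in>C. - bsign (bdot c z))"
    using c0(2) by (intro sum.cong) (auto simp: bdot_def algebra_simps sum.distrib bsign_add)
  finally show ?thesis using False by (simp add: sum_negf)
qed

lemma sum_bsign_bdot: "(\<Sum>z\<in>UNIV. bsign (bdot c z)) = (if c = (0 :: bit ^ 'n) then 2 ^ CARD('n::finite) else (0::real))"
proof -
  have "(\<Sum>z\<in>UNIV. bsign (bdot c z)) = (\<Prod>i\<in>UNIV. \<Sum>a\<in>UNIV. bsign (c $ i * a) :: real)"
    unfolding bdot_def bsign_sum by (rule sum_fun_prod)
  also have "\<dots> = (\<Prod>i\<in>UNIV. if c $ i = 0 then 2 else 0)"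
    by (intro prod.cong) (auto simp: UNIV_bit)
  also have "\<dots> = (if c = 0 then 2 ^ CARD('n) else 0)"
    by (auto simp: vec_eq_iff)
  finally show ?thesis .
qed

text \<open>Double counting: the signs \<open>bsign (bdot c z)\<close> are summed over
  \<open>C\<close> first and over all words first.\<close>

lemma card_dual_code:
  fixes C :: "(bit ^ 'n::finite) set"
  assumes "vec.subspace C"
  shows "card (dual_coset C (\<lambda>_. 0)) * card C = 2 ^ CARD('n)"
proof -
  let ?S = "\<Sum>c\<in>C. \<Sum>z\<in>UNIV. bsign (bdot c z) :: real"
  have "?S = (\<Sum>z\<in>UNIV. \<Sum>c\<in>C. bsign (bdot c z))"
    by (rule sum.swap)
  also have "\<dots> = real (card (dual_coset C (\<lambda>_. 0)) * card C)"
    by (simp add: sum_bsign_bdot_code[OF assms] sum.If_cases)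
  finally have 1: "?S = real (card (dual_coset C (\<lambda>_. 0)) * card C)" .
  have "?S = (\<Sum>c\<in>C. if c = 0 then 2 ^ CARD('n) else 0)"
    by (simp add: sum_bsign_bdot)
  also have "\<dots> = 2 ^ CARD('n)"
    using vec.subspace_0[OF assms] by simp
  finally show ?thesis using 1 by (metis of_nat_eq_iff of_nat_numeral of_nat_power)
qed

section \<open>Decoding the dual channel\<close>

text \<open>Taking the real part matches \<open>positive_op\<close>, so the form need not be shown
  to be real.\<close>

definition qform :: "complex ^ 'i ^ 'i \<Rightarrow> complex ^ 'i \<Rightarrow> real" where
  "qform A v = Re (\<Sum>i\<in>UNIV. \<Sum>j\<in>UNIV. cnj (v $ i) * A $ i $ j * v $ j)"

lemma qform_scaleR: "qform A (r *\<^sub>R v) = r\<^sup>2 * qform A v"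
proof -
  have "(\<Sum>i\<in>UNIV. \<Sum>j\<in>UNIV. cnj ((r *\<^sub>R v) $ i) * A $ i $ j * (r *\<^sub>R v) $ j) =
    complex_of_real (r\<^sup>2) * (\<Sum>i\<in>UNIV. \<Sum>j\<in>UNIV. cnj (v $ i) * A $ i $ j * v $ j)"
    unfolding sum_distrib_left vector_scaleR_component
    unfolding scaleR_conv_of_real
    by (intro sum.cong) (auto simp: power2_eq_square)
  then show ?thesis
    unfolding qform_def by (simp only: times_complex.sel Re_complex_of_real Im_complex_of_real)
qed

text \<open>An identity for every matrix. For a positive one and nonnegative weights, the last term
  has the sign that gives convexity.\<close>

lemma qform_convex_combination:
  fixes A :: "complex ^ 'i::finite ^ 'i"
  assumes "s + t = 1"
  shows "qform A (s *\<^sub>R x + t *\<^sub>R y) = s * qform A x + t * qform A y - s * t * qform A (x - y)"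
proof -
  let ?B = "\<lambda>v. \<Sum>i\<in>UNIV. \<Sum>j\<in>UNIV. cnj (v $ i) * A $ i $ j * v $ j"
  have s: "s = 1 - t" using assms by simp
  have "?B (s *\<^sub>R x + t *\<^sub>R y) =
    complex_of_real s * ?B x + complex_of_real t * ?B y - complex_of_real (s * t) * ?B (x - y)"
    unfolding sum_distrib_left sum.distrib[symmetric] sum_subtractf[symmetric] s
      vector_add_component vector_minus_component vector_scaleR_component
    unfolding scaleR_conv_of_real
    by (intro sum.cong) (auto simp: algebra_simps)
  then have "Re (?B (s *\<^sub>R x + t *\<^sub>R y)) =
    Re (complex_of_real s * ?B x + complex_of_real t * ?B y - complex_of_real (s * t) * ?B (x - y))"
    by simp
  also have "\<dots> = s * Re (?B x) + t * Re (?B y) - s * t * Re (?B (x - y))"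
    by (simp del: of_real_mult)
  finally show ?thesis
    unfolding qform_def .
qed

lemma convex_on_qform:
  fixes A :: "complex ^ 'i::finite ^ 'i"
  assumes "positive_op A"
  shows "convex_on UNIV (qform A)"
proof (rule convex_onI)
  fix t :: real and x y :: "complex ^ 'i"
  assume t: "0 < t" "t < 1"
  have "0 \<le> qform A (x - y)"
    using assms unfolding positive_op_def qform_def by blast
  then have "0 \<le> (1 - t) * t * qform A (x - y)"
    using t by simp
  then show "qform A ((1 - t) *\<^sub>R x + t *\<^sub>R y) \<le> (1 - t) * qform A x + t * qform A y"
    using qform_convex_combination[of "1 - t" t A x y] by simp
qed simp

text \<open>Convexity of the quadratic form, with weights proportional to \<open>a\<close>. With \<open>a t\<close> the norm of
  \<open>\<xi> t\<close>, the sum over the elements of a POVM is at most \<open>(\<Sum>t. a t)\<^sup>2\<close>, and the signs of the \<open>\<xi> t\<close>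
  do not matter.\<close>

lemma qform_sum_le:
  fixes A :: "complex ^ 'i::finite ^ 'i" and \<xi> :: "'t::finite \<Rightarrow> complex ^ 'i"
  assumes A: "positive_op A" and a: "\<And>t. 0 \<le> a t" and a0: "\<And>t. a t = 0 \<Longrightarrow> \<xi> t = 0"
  shows "qform A (\<Sum>t\<in>UNIV. \<xi> t) \<le> (\<Sum>t\<in>UNIV. a t) * (\<Sum>t\<in>UNIV. qform A (\<xi> t) / a t)"
proof (cases "(\<Sum>t\<in>UNIV. a t) = 0")
  case True
  then have "\<xi> t = 0" for t
    using a a0 by (simp add: sum_nonneg_eq_0_iff)
  then show ?thesis
    using qform_scaleR[of A 0 0] by simp
next
  case False
  define S where "S = (\<Sum>t\<in>UNIV. a t)"
  have S: "S > 0"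
    using False a unfolding S_def by (simp add: sum_nonneg less_le)
  have "qform A (\<Sum>t\<in>UNIV. \<xi> t) = qform A (\<Sum>t\<in>UNIV. (a t / S) *\<^sub>R ((S / a t) *\<^sub>R \<xi> t))"
    using S by (intro arg_cong[of _ _ "qform A"] sum.cong) (auto simp: a0)
  also have "\<dots> \<le> (\<Sum>t\<in>UNIV. (a t / S) * qform A ((S / a t) *\<^sub>R \<xi> t))"
    using S a by (intro convex_on_sum[OF _ _ convex_on_qform[OF A]])
      (auto simp: S_def sum_divide_distrib[symmetric])
  also have "\<dots> = (\<Sum>t\<in>UNIV. S * (qform A (\<xi> t) / a t))"
    using S by (intro sum.cong) (auto simp: qform_scaleR power2_eq_square)
  finally show ?thesis
    by (simp add: S_def sum_distrib_left)
qed

lemma sum_qform_povm: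
  fixes v :: "complex ^ 'i::finite"
  assumes "povm C \<Lambda>"
  shows "(\<Sum>c\<in>C. qform (\<Lambda> c) v) = (\<Sum>i\<in>UNIV. (cmod (v $ i))\<^sup>2)"
proof -
  have "(\<Sum>c\<in>C. qform (\<Lambda> c) v) =
    Re (\<Sum>c\<in>C. \<Sum>i\<in>UNIV. \<Sum>j\<in>UNIV. cnj (v $ i) * \<Lambda> c $ i $ j * v $ j)"
    by (simp add: qform_def)
  also have "(\<Sum>c\<in>C. \<Sum>i\<in>UNIV. \<Sum>j\<in>UNIV. cnj (v $ i) * \<Lambda> c $ i $ j * v $ j) =
    (\<Sum>i\<in>UNIV. \<Sum>j\<in>UNIV. cnj (v $ i) * (\<Sum>c\<in>C. \<Lambda> c) $ i $ j * v $ j)"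
    by (simp add: sum_distrib_left sum_distrib_right sum_component sum.swap[of _ UNIV C])
  also have "\<dots> = (\<Sum>i\<in>UNIV. \<Sum>j\<in>UNIV. if i = j then cnj (v $ i) * v $ j else 0)"
    using assms by (intro sum.cong) (auto simp: povm_def mat_def)
  also have "\<dots> = complex_of_real (\<Sum>i\<in>UNIV. (cmod (v $ i))\<^sup>2)"
    unfolding of_real_sum complex_norm_square by (simp add: mult.commute)
  finally show ?thesis by simp
qed

text \<open>The signs enter \<open>qform\<close> squared, and the measurement operators sum to the
  identity, so each \<open>t\<close> contributes \<open>(a t)\<^sup>2 / a t\<close>. In the
  application, \<open>s c\<close> is the character of the code word \<open>c\<close>.\<close>

lemma povm_signed_sum_le:
  fixes \<xi> :: "'t::finite \<Rightarrow> complex ^ 'i::finite" and s :: "'c \<Rightarrow> 't \<Rightarrow> real"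
  assumes povm: "povm C \<Lambda>"
    and s: "\<And>c t. (s c t)\<^sup>2 = 1"
    and a: "\<And>t. 0 \<le> a t" "\<And>t. (a t)\<^sup>2 = (\<Sum>i\<in>UNIV. (cmod (\<xi> t $ i))\<^sup>2)"
  shows "(\<Sum>c\<in>C. qform (\<Lambda> c) (\<Sum>t\<in>UNIV. s c t *\<^sub>R \<xi> t)) \<le> (\<Sum>t\<in>UNIV. a t)\<^sup>2"
proof -
  have a0: "s c t *\<^sub>R \<xi> t = 0" if "a t = 0" for c t
    using a(2)[of t] that by (auto simp: sum_nonneg_eq_0_iff vec_eq_iff)
  have "(\<Sum>c\<in>C. qform (\<Lambda> c) (\<Sum>t\<in>UNIV. s c t *\<^sub>R \<xi> t)) \<le>
    (\<Sum>c\<in>C. (\<Sum>t\<in>UNIV. a t) * (\<Sum>t\<in>UNIV. qform (\<Lambda> c) (s c t *\<^sub>R \<xi> t) / a t))"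
    using povm a a0 by (intro sum_mono qform_sum_le) (auto simp: povm_def)
  also have "\<dots> = (\<Sum>t\<in>UNIV. a t) * (\<Sum>t\<in>UNIV. (\<Sum>c\<in>C. qform (\<Lambda> c) (\<xi> t)) / a t)"
    unfolding sum_distrib_left[symmetric] qform_scaleR s
    by (subst sum.swap) (simp add: sum_divide_distrib)
  also have "\<dots> = (\<Sum>t\<in>UNIV. a t) * (\<Sum>t\<in>UNIV. a t)"
    by (simp only: sum_qform_povm[OF povm] a(2)[symmetric]) (simp add: power2_eq_square)
  finally show ?thesis by (simp add: power2_eq_square)
qed

section \<open>Block outputs of the dual channel, split along cosets\<close>

definition block_prob :: "(bit \<Rightarrow> 'x pmf) \<Rightarrow> ('n::finite \<Rightarrow> bit) \<Rightarrow> ('n \<Rightarrow> 'x) \<Rightarrow> real" where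
  "block_prob W z x = (\<Prod>i\<in>UNIV. pmf (W (z i)) (x i))"

text \<open>The output distribution when the input word is uniform on the coset of
  \<open>t\<close>.\<close>

definition coset_prob ::
  "(bit \<Rightarrow> 'x pmf) \<Rightarrow> (bit ^ 'n::finite) set \<Rightarrow> ('n \<Rightarrow> bit) \<Rightarrow> ('n \<Rightarrow> 'x) \<Rightarrow> real" where
  "coset_prob W C t x = (\<Sum>z\<in>dual_coset C t. block_prob W z x) / card (dual_coset C t)"

text \<open>Tracing out the systems B leaves a mixture of unnormalized pure states, one for each
  basis word \<open>b\<close>; this is the vector that belongs to \<open>b\<close>.\<close>

definition theta_block ::
  "(bit \<Rightarrow> complex ^ ('b::finite \<times> 'd::finite)) \<Rightarrow> bit ^ 'n::finite \<Rightarrow> ('n \<Rightarrow> 'b) \<Rightarrow> complex ^ ('n \<Rightarrow> bit \<times> 'd)"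
where
  "theta_block \<phi> c b = (\<chi> f. \<Prod>i\<in>UNIV. theta_state \<phi> (c $ i) $ (fst (f i), b i, snd (f i)))"

lemma theta_state_bsign:
  "theta_state \<phi> u $ (z, b, d) = bsign (u * z) * (complex_of_real (1 / sqrt 2) * \<phi> z $ (b, d))"
  by (simp add: theta_state_def bsign_def)

text \<open>A code word enters only by a sign that is constant on each coset of the dual
  code.\<close>

lemma theta_block_bsign:
  "theta_block \<phi> c b $ f = bsign (bdot c (fst \<circ> f)) * theta_block \<phi> 0 b $ f"
  by (simp add: theta_block_def theta_state_bsign bdot_def bsign_sum prod.distrib[symmetric])

lemma block_output_eq:
  assumes "\<And>u. V u = trace_mid (ketbra (theta_state \<phi> u))"
  shows "block_output V c $ f $ g =
    (\<Sum>b\<in>UNIV. theta_block \<phi> c b $ f * cnj (theta_block \<phi> c b $ g))"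
  by (simp add: block_output_def tensor_op_def assms trace_mid_def ketbra_def theta_block_def
      sum_fun_prod[symmetric] prod.distrib)

lemma trace_block_output:
  fixes \<Lambda> :: "complex ^ ('n::finite \<Rightarrow> bit \<times> 'd::finite) ^ ('n \<Rightarrow> bit \<times> 'd)"
    and \<phi> :: "bit \<Rightarrow> complex ^ ('b::finite \<times> 'd)"
  assumes "\<And>u. V u = trace_mid (ketbra (theta_state \<phi> u))"
  shows "Re (trace (\<Lambda> ** block_output V c)) = (\<Sum>b\<in>UNIV. qform \<Lambda> (theta_block \<phi> c b))"
proof -
  let ?\<psi> = "theta_block \<phi> c"
  have "trace (\<Lambda> ** block_output V c) =
    (\<Sum>f\<in>UNIV. \<Sum>g\<in>UNIV. \<Sum>b\<in>UNIV. cnj (?\<psi> b $ f) * \<Lambda> $ f $ g * ?\<psi> b $ g)"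
    by (simp add: trace_def matrix_matrix_mult_def block_output_eq[OF assms] sum_distrib_left
        mult_ac)
  also have "\<dots> = (\<Sum>b\<in>UNIV. \<Sum>f\<in>UNIV. \<Sum>g\<in>UNIV. cnj (?\<psi> b $ f) * \<Lambda> $ f $ g * ?\<psi> b $ g)"
    by (subst (2) sum.swap, subst sum.swap) (rule refl)
  finally show ?thesis by (simp add: qform_def)
qed

text \<open>A diagonal entry of the reduced state. Through it the chosen purifications enter the
  bounds only by the channel probabilities.\<close>

lemma purification_norm:
  assumes "purification \<psi> (diag_state p)"
  shows "(\<Sum>k\<in>UNIV. (cmod (\<psi> $ (x, k)))\<^sup>2) = pmf p x"
proof -
  have "complex_of_real (\<Sum>k\<in>UNIV. (cmod (\<psi> $ (x, k)))\<^sup>2) = trace_snd (ketbra \<psi>) $ x $ x"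
    unfolding of_real_sum complex_norm_square by (simp add: trace_snd_def ketbra_def)
  also have "\<dots> = complex_of_real (pmf p x)"
    using assms by (simp add: purification_def diag_state_def)
  finally show ?thesis by (simp only: of_real_eq_iff)
qed

text \<open>The purifying systems are summed out coordinate by coordinate; the power of 2 collects
  the squares of the normalization \<open>1 / sqrt 2\<close>.\<close>

lemma coset_block_norm:
  fixes \<phi> :: "bit \<Rightarrow> complex ^ ('x::finite \<times> 'd::finite)" and b :: "'n::finite \<Rightarrow> 'x"
  assumes "\<And>z. purification (\<phi> z) (diag_state (W z))"
  shows "(\<Sum>f\<in>UNIV. (cmod (if fst \<circ> f \<in> S then theta_block \<phi> 0 b $ f else 0))\<^sup>2) =
    (\<Sum>z\<in>S. block_prob W z b) / 2 ^ CARD('n)"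
proof -
  have *: "(cmod (theta_block \<phi> 0 b $ f))\<^sup>2 =
    (\<Prod>i\<in>UNIV. (cmod (\<phi> ((fst \<circ> f) i) $ (b i, (snd \<circ> f) i)))\<^sup>2 / 2)" for f
    by (simp add: theta_block_def theta_state_bsign norm_mult prod_norm[symmetric] norm_divide
        prod_power_distrib power_divide power_mult_distrib)
  have "(\<Sum>f\<in>UNIV. (cmod (if fst \<circ> f \<in> S then theta_block \<phi> 0 b $ f else 0))\<^sup>2) =
    (\<Sum>f\<in>UNIV. if fst \<circ> f \<in> S then
      (\<Prod>i\<in>UNIV. (cmod (\<phi> ((fst \<circ> f) i) $ (b i, (snd \<circ> f) i)))\<^sup>2 / 2) else 0)"
    using * by (intro sum.cong) auto
  also have "\<dots> = (\<Sum>z\<in>UNIV. \<Sum>k\<in>UNIV. if z \<in> S then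
      (\<Prod>i\<in>UNIV. (cmod (\<phi> (z i) $ (b i, k i)))\<^sup>2 / 2) else 0)"
    by (rule sum_fun_pair)
  also have "\<dots> = (\<Sum>z\<in>UNIV. if z \<in> S then
      \<Sum>k\<in>UNIV. \<Prod>i\<in>UNIV. (cmod (\<phi> (z i) $ (b i, k i)))\<^sup>2 / 2 else 0)"
    by (intro sum.cong) auto
  also have "\<dots> = (\<Sum>z\<in>S. \<Sum>k\<in>UNIV. \<Prod>i\<in>UNIV. (cmod (\<phi> (z i) $ (b i, k i)))\<^sup>2 / 2)"
    by (simp add: sum.If_cases)
  also have "\<dots> = (\<Sum>z\<in>S. \<Prod>i\<in>UNIV. pmf (W (z i)) (b i) / 2)"
    by (simp add: sum_fun_prod[where g="\<lambda>i k. (cmod (\<phi> (z i) $ (b i, k)))\<^sup>2 / 2" for z]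
        sum_divide_distrib[symmetric] purification_norm[OF assms])
  also have "\<dots> = (\<Sum>z\<in>S. block_prob W z b) / 2 ^ CARD('n)"
    by (simp add: block_prob_def prod_dividef sum_divide_distrib)
  finally show ?thesis .
qed

text \<open>The decoder also has to succeed when it is told the traced-out word \<open>b\<close>. For each \<open>b\<close> the
  outputs are pure, and up to signs they are sums of the same orthogonal vectors, one per coset.\<close>

lemma success_le:
  fixes W :: "bit \<Rightarrow> 'x::finite pmf"
    and V :: "bit \<Rightarrow> complex ^ (bit \<times> 'd::finite) ^ (bit \<times> 'd)"
    and C :: "(bit ^ 'n::finite) set"
  assumes dual: "dual_channel W V" and C: "vec.subspace C" and povm: "povm C \<Lambda>"
  shows "1 - avg_error V C \<Lambda> \<le> (\<Sum>b\<in>UNIV. ((\<Sum>t\<in>UNIV. sqrt (coset_prob W C t b)) / 2 ^ CARD('n))\<^sup>2)"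
proof -
  obtain \<phi> :: "bit \<Rightarrow> complex ^ ('x \<times> 'd)" where
    pur: "\<And>z. purification (\<phi> z) (diag_state (W z))" and
    V: "\<And>u. V u = trace_mid (ketbra (theta_state \<phi> u))"
    using dual unfolding dual_channel_def by blast
  define K where "K = real (card (dual_coset C (\<lambda>_. 0)))"
  define N where "N = (2::real) ^ CARD('n)"
  have KC: "K * real (card C) = N"
    using card_dual_code[OF C] unfolding K_def N_def by (metis of_nat_mult of_nat_numeral of_nat_power)
  have N: "N > 0" by (simp add: N_def)
  then have pos: "K > 0" "real (card C) > 0"
    using KC by (auto simp: K_def intro!: Nat.gr0I)
  have cardK: "real (card (dual_coset C t)) = K" for t
    unfolding K_def by (subst card_dual_coset) (rule refl)
  \<comment> \<open>The component, on the coset of \<open>t\<close>, of the vector without signs;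
    \<open>a t b\<close> is its norm.\<close>
  define \<xi> where "\<xi> t b = (\<chi> f. if fst \<circ> f \<in> dual_coset C t then theta_block \<phi> 0 b $ f else 0)" for t b
  define a where "a t b = sqrt (K / N) * sqrt (coset_prob W C t b)" for t b
  have a: "(a t b)\<^sup>2 = (\<Sum>f\<in>UNIV. (cmod (\<xi> t b $ f))\<^sup>2)" for t b
  proof -
    have "(\<Sum>f\<in>UNIV. (cmod (\<xi> t b $ f))\<^sup>2) = (\<Sum>z\<in>dual_coset C t. block_prob W z b) / N"
      unfolding \<xi>_def N_def using coset_block_norm[OF pur, where S="dual_coset C t" and b=b] by simp
    also have "\<dots> = K / N * coset_prob W C t b"
      using pos by (simp add: coset_prob_def cardK)
    also have "\<dots> = (a t b)\<^sup>2"
      unfolding a_def power_mult_distrib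
      by (subst (1 2) real_sqrt_pow2)
        (use pos N in \<open>auto simp: coset_prob_def block_prob_def intro!: divide_nonneg_nonneg sum_nonneg prod_nonneg\<close>)
    finally show ?thesis ..
  qed
  \<comment> \<open>The sign of \<open>c\<close> is constant on a coset and factors out. Each index
    \<open>f\<close> is met once for each of the \<open>K\<close> representatives of its coset,
    whence the factor \<open>K\<close>.\<close>
  have decomp: "(\<Sum>t\<in>UNIV. bsign (bdot c t) *\<^sub>R \<xi> t b) = K *\<^sub>R theta_block \<phi> c b" if "c \<in> C" for c b
  proof (rule vec_eq_iff[THEN iffD2], rule allI)
    fix f
    have "(\<Sum>t\<in>UNIV. bsign (bdot c t) *\<^sub>R \<xi> t b) $ f =
      (\<Sum>t\<in>UNIV. if t \<in> dual_coset C (fst \<circ> f)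
        then bsign (bdot c (fst \<circ> f)) * theta_block \<phi> 0 b $ f else 0)"
      unfolding sum_component
    proof (intro sum.cong refl)
      fix t
      have "bdot c (fst \<circ> f) = bdot c t" if "fst \<circ> f \<in> dual_coset C t"
        using that \<open>c \<in> C\<close> by (simp add: dual_coset_def)
      then show "(bsign (bdot c t) *\<^sub>R \<xi> t b) $ f = (if t \<in> dual_coset C (fst \<circ> f)
        then bsign (bdot c (fst \<circ> f)) * theta_block \<phi> 0 b $ f else 0)"
        by (auto simp: \<xi>_def mem_dual_coset_commute[of _ C "fst \<circ> f"] bsign_def)
    qed
    also have "\<dots> = (K *\<^sub>R theta_block \<phi> c b) $ f"
      unfolding vector_scaleR_component theta_block_bsign[of \<phi> c]
      by (simp add: sum.If_cases cardK[symmetric, of "fst \<circ> f"] scaleR_conv_of_real)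
    finally show "(\<Sum>t\<in>UNIV. bsign (bdot c t) *\<^sub>R \<xi> t b) $ f = (K *\<^sub>R theta_block \<phi> c b) $ f" .
  qed
  have le: "(\<Sum>c\<in>C. qform (\<Lambda> c) (theta_block \<phi> c b)) \<le>
    (\<Sum>t\<in>UNIV. sqrt (coset_prob W C t b))\<^sup>2 / (K * N)" for b
  proof -
    have "K\<^sup>2 * (\<Sum>c\<in>C. qform (\<Lambda> c) (theta_block \<phi> c b)) =
      (\<Sum>c\<in>C. qform (\<Lambda> c) (\<Sum>t\<in>UNIV. bsign (bdot c t) *\<^sub>R \<xi> t b))"
      by (simp add: decomp qform_scaleR sum_distrib_left)
    also have "\<dots> \<le> (\<Sum>t\<in>UNIV. a t b)\<^sup>2"
      by (rule povm_signed_sum_le[OF povm])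
        (use pos N a in \<open>auto simp: a_def bsign_def coset_prob_def block_prob_def
          intro!: mult_nonneg_nonneg divide_nonneg_nonneg sum_nonneg prod_nonneg\<close>)
    also have "\<dots> = K / N * (\<Sum>t\<in>UNIV. sqrt (coset_prob W C t b))\<^sup>2"
      unfolding a_def sum_distrib_left[symmetric] power_mult_distrib
      using pos N by simp
    finally show ?thesis
      using pos N by (simp add: field_simps power2_eq_square)
  qed
  have "1 - avg_error V C \<Lambda> = (1 / card C) * (\<Sum>b\<in>UNIV. \<Sum>c\<in>C. qform (\<Lambda> c) (theta_block \<phi> c b))"
    unfolding avg_error_def trace_block_output[OF V] by (subst sum.swap) simp
  also have "\<dots> \<le> (1 / card C) * (\<Sum>b\<in>UNIV. (\<Sum>t\<in>UNIV. sqrt (coset_prob W C t b))\<^sup>2 / (K * N))"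
    by (intro mult_left_mono sum_mono le) auto
  \<comment> \<open>By \<open>KC\<close>, the prefactor \<open>1 / (card C * K * N)\<close> is
    \<open>1 / N\<^sup>2\<close>.\<close>
  also have "\<dots> = (\<Sum>b\<in>UNIV. ((\<Sum>t\<in>UNIV. sqrt (coset_prob W C t b)) / N)\<^sup>2)"
    unfolding sum_distrib_left using pos N KC
    by (intro sum.cong) (auto simp: power_divide power2_eq_square field_simps)
  finally show ?thesis unfolding N_def .
qed

section \<open>Output distributions of the cosets\<close>

text \<open>The output distribution of a uniformly random input word, in product form.\<close>

definition out_prob :: "(bit \<Rightarrow> 'x pmf) \<Rightarrow> ('n::finite \<Rightarrow> 'x) \<Rightarrow> real" where
  "out_prob W x = (\<Prod>i\<in>UNIV. (pmf (W 0) (x i) + pmf (W 1) (x i)) / 2)"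

lemma card_fun_bit: "CARD('n::finite \<Rightarrow> bit) = 2 ^ CARD('n)"
  by (simp add: card_fun UNIV_bit numeral_2_eq_2)

lemma block_prob_nonneg: "0 \<le> block_prob W z x"
  by (simp add: block_prob_def prod_nonneg)

lemma coset_prob_nonneg: "0 \<le> coset_prob W C t x"
  by (simp add: coset_prob_def sum_nonneg block_prob_nonneg)

lemma out_prob_nonneg: "0 \<le> out_prob W x"
  by (simp add: out_prob_def prod_nonneg)

lemma sum_block_prob: "(\<Sum>z\<in>UNIV. block_prob W z x) = 2 ^ CARD('n) * out_prob W (x :: 'n::finite \<Rightarrow> 'x)"
  unfolding block_prob_def sum_fun_prod[where g="\<lambda>i a. pmf (W a) (x i)"] out_prob_def
  by (simp add: UNIV_bit prod_dividef)

lemma sum_out_prob: "(\<Sum>x\<in>UNIV. out_prob W (x :: 'n::finite \<Rightarrow> 'x::finite)) = 1"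
  unfolding out_prob_def sum_fun_prod[where g="\<lambda>_ a. (pmf (W 0) a + pmf (W 1) a) / 2"]
  by (simp add: sum_divide_distrib[symmetric] sum.distrib sum_pmf_eq_1)

lemma dual_coset_nonempty [simp]: "dual_coset C t \<noteq> {}"
  by (metis empty_iff mem_dual_coset_self)

text \<open>Each \<open>z\<close> is counted once for every representative of its coset, which
  cancels the normalization.\<close>

lemma sum_coset_average:
  fixes C :: "(bit ^ 'n::finite) set" and f :: "('n \<Rightarrow> bit) \<Rightarrow> real"
  shows "(\<Sum>t\<in>UNIV. (\<Sum>z\<in>dual_coset C t. f z) / card (dual_coset C t)) = (\<Sum>z\<in>UNIV. f z)"
proof -
  let ?K = "real (card (dual_coset C (\<lambda>_. 0)))"
  have "(\<Sum>t\<in>UNIV. (\<Sum>z\<in>dual_coset C t. f z) / card (dual_coset C t)) =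
    (\<Sum>t\<in>UNIV. \<Sum>z\<in>dual_coset C t. f z) / ?K"
    unfolding sum_divide_distrib by (subst card_dual_coset) (rule refl)
  also have "(\<Sum>t\<in>UNIV. \<Sum>z\<in>dual_coset C t. f z) = (\<Sum>t\<in>UNIV. \<Sum>z\<in>UNIV. if t \<in> dual_coset C z then f z else 0)"
    by (rule sum.cong[OF refl], subst mem_dual_coset_commute) (simp add: sum.If_cases)
  also have "\<dots> = (\<Sum>z\<in>UNIV. \<Sum>t\<in>UNIV. if t \<in> dual_coset C z then f z else 0)"
    by (rule sum.swap)
  also have "\<dots> = (\<Sum>z\<in>UNIV. card (dual_coset C z) * f z)"
    by (simp add: sum.If_cases)
  also have "\<dots> = ?K * (\<Sum>z\<in>UNIV. f z)"
    unfolding sum_distrib_left by (subst card_dual_coset) (rule refl)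
  finally show ?thesis
    by simp
qed

lemma sum_coset_prob:
  "(\<Sum>t\<in>UNIV. coset_prob W C t x) = 2 ^ CARD('n) * out_prob W (x :: 'n::finite \<Rightarrow> 'x)"
  unfolding coset_prob_def sum_coset_average by (rule sum_block_prob)

text \<open>Cauchy-Schwarz for \<open>\<bar>Q - p\<bar> = \<bar>\<surd>Q - \<surd>p\<bar> (\<surd>Q + \<surd>p)\<close>.\<close>

lemma positive_part_le:
  fixes p :: "'t::finite \<Rightarrow> real" and Q g :: real
  assumes p: "\<And>t. 0 \<le> p t" and Q: "(\<Sum>t\<in>UNIV. p t) = CARD('t) * Q"
    and g: "(\<Sum>t\<in>UNIV. sqrt (p t)) = CARD('t) * g"
  shows "(\<Sum>t\<in>UNIV. max 0 (Q - p t)) / CARD('t) \<le> sqrt Q * sqrt (Q - g\<^sup>2)"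
    and "g\<^sup>2 \<le> Q"
proof -
  define N where "N = real CARD('t)"
  have N: "N > 0" by (simp add: N_def)
  have Q0: "0 \<le> Q"
    using sum_nonneg[of UNIV p] p N by (simp add: Q zero_le_mult_iff)
  have g0: "0 \<le> g"
    using sum_nonneg[of UNIV "\<lambda>t. sqrt (p t)"] p N by (simp add: g zero_le_mult_iff)
  define a where "a t = \<bar>sqrt Q - sqrt (p t)\<bar>" for t
  define b where "b t = sqrt Q + sqrt (p t)" for t
  have cross: "(\<Sum>t\<in>UNIV. 2 * sqrt Q * sqrt (p t)) = N * (2 * sqrt Q * g)"
    by (simp add: sum_distrib_left[symmetric] g N_def)
  have a2: "(\<Sum>t\<in>UNIV. (a t)\<^sup>2) = N * (2 * Q - 2 * sqrt Q * g)"
  proof -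
    have "(\<Sum>t\<in>UNIV. (a t)\<^sup>2) = (\<Sum>t\<in>UNIV. Q + p t - 2 * sqrt Q * sqrt (p t))"
      using p Q0 by (intro sum.cong) (auto simp: a_def power2_diff)
    also have "\<dots> = N * (2 * Q - 2 * sqrt Q * g)"
      unfolding sum.distrib sum_subtractf cross by (simp add: Q N_def algebra_simps)
    finally show ?thesis .
  qed
  have b2: "(\<Sum>t\<in>UNIV. (b t)\<^sup>2) = N * (2 * Q + 2 * sqrt Q * g)"
  proof -
    have "(\<Sum>t\<in>UNIV. (b t)\<^sup>2) = (\<Sum>t\<in>UNIV. Q + p t + 2 * sqrt Q * sqrt (p t))"
      using p Q0 by (intro sum.cong) (auto simp: b_def power2_sum)
    also have "\<dots> = N * (2 * Q + 2 * sqrt Q * g)"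
      unfolding sum.distrib cross by (simp add: Q N_def algebra_simps)
    finally show ?thesis .
  qed
  \<comment> \<open>A sum of squares is nonnegative, which gives \<open>g \<le> sqrt Q\<close> after
    division by \<open>sqrt Q\<close>; the case \<open>Q = 0\<close> is separate.\<close>
  have "0 \<le> N * (2 * Q - 2 * sqrt Q * g)"
    unfolding a2[symmetric] by (simp add: sum_nonneg)
  then have "sqrt Q * g \<le> sqrt Q * sqrt Q"
    using N Q0 by (simp add: zero_le_mult_iff)
  then have "g \<le> sqrt Q" if "0 < Q"
    using that by (metis mult_le_cancel_left_pos real_sqrt_gt_zero)
  moreover have "g = 0" if "Q = 0"
  proof -
    have "p t = 0" for t
      using Q p that by (simp add: sum_nonneg_eq_0_iff)
    then show ?thesis using g by simp
  qed
  ultimately have "g \<le> sqrt Q"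
    using Q0 by fastforce
  then show g2: "g\<^sup>2 \<le> Q"
    using g0 Q0 power_mono[of g "sqrt Q" 2] by simp
  have ab: "a t * b t = \<bar>Q - p t\<bar>" for t
  proof -
    have "a t * b t = \<bar>(sqrt Q - sqrt (p t)) * (sqrt Q + sqrt (p t))\<bar>"
      unfolding abs_mult a_def b_def using p[of t] Q0 by simp
    also have "\<dots> = \<bar>Q - p t\<bar>"
      using p[of t] Q0 by (simp add: algebra_simps)
    finally show ?thesis .
  qed
  \<comment> \<open>The deviations \<open>Q - p t\<close> sum to zero, so their positive parts make
    up half of the sum of absolute values.\<close>
  have "2 * (\<Sum>t\<in>UNIV. max 0 (Q - p t)) = (\<Sum>t\<in>UNIV. \<bar>Q - p t\<bar> + (Q - p t))"
    unfolding sum_distrib_left by (intro sum.cong) (auto simp: max_def)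
  also have "\<dots> = (\<Sum>t\<in>UNIV. a t * b t)"
    by (simp add: sum.distrib sum_subtractf Q ab)
  also have "\<dots> \<le> sqrt ((2 * N * (sqrt Q * sqrt (Q - g\<^sup>2)))\<^sup>2)"
  proof (rule real_le_rsqrt)
    have "(\<Sum>t\<in>UNIV. a t * b t)\<^sup>2 \<le> (\<Sum>t\<in>UNIV. (a t)\<^sup>2) * (\<Sum>t\<in>UNIV. (b t)\<^sup>2)"
      by (rule Cauchy_Schwarz_ineq_sum)
    also have "\<dots> = (2 * N)\<^sup>2 * (Q * Q - (sqrt Q * sqrt Q) * g\<^sup>2)"
      unfolding a2 b2 by (simp add: algebra_simps power2_eq_square)
    also have "\<dots> = (2 * N * (sqrt Q * sqrt (Q - g\<^sup>2)))\<^sup>2"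
      using Q0 g2 by (simp add: power_mult_distrib algebra_simps)
    finally show "(\<Sum>t\<in>UNIV. a t * b t)\<^sup>2 \<le> (2 * N * (sqrt Q * sqrt (Q - g\<^sup>2)))\<^sup>2" .
  qed
  also have "\<dots> = 2 * N * (sqrt Q * sqrt (Q - g\<^sup>2))"
    using N Q0 g2 by simp
  finally show "(\<Sum>t\<in>UNIV. max 0 (Q - p t)) / CARD('t) \<le> sqrt Q * sqrt (Q - g\<^sup>2)"
    using N by (simp add: N_def[symmetric] field_simps)
qed

text \<open>Summed over \<open>x\<close>, this is the total variation distance between the output
  distributions of a coset and of the uniform input, averaged over the cosets.\<close>

definition coset_deficit :: "(bit \<Rightarrow> 'x pmf) \<Rightarrow> (bit ^ 'n::finite) set \<Rightarrow> ('n \<Rightarrow> 'x) \<Rightarrow> real" where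
  "coset_deficit W C x = (\<Sum>t\<in>UNIV. max 0 (out_prob W x - coset_prob W C t x)) / 2 ^ CARD('n)"

text \<open>Cauchy-Schwarz over \<open>x\<close>: the values \<open>out_prob W x\<close> sum to 1,
  and the gaps \<open>out_prob W x - (g x)\<^sup>2\<close> sum to at most the error, by
  \<open>success_le\<close>.\<close>

lemma sum_coset_deficit_le:
  fixes W :: "bit \<Rightarrow> 'x::finite pmf"
    and V :: "bit \<Rightarrow> complex ^ (bit \<times> 'd::finite) ^ (bit \<times> 'd)"
    and C :: "(bit ^ 'n::finite) set"
  assumes "dual_channel W V" and "vec.subspace C" and "povm C \<Lambda>"
  shows "(\<Sum>x\<in>UNIV. coset_deficit W C x) \<le> sqrt (avg_error V C \<Lambda>)" and "0 \<le> avg_error V C \<Lambda>"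
proof -
  let ?N = "2 ^ CARD('n) :: real"
  define g where "g x = (\<Sum>t\<in>UNIV. sqrt (coset_prob W C t x)) / ?N" for x
  let ?Q = "out_prob W :: ('n \<Rightarrow> 'x) \<Rightarrow> real"
  have N: "real CARD('n \<Rightarrow> bit) = ?N"
    by (simp add: card_fun_bit)
  have le: "coset_deficit W C x \<le> sqrt (?Q x) * sqrt (?Q x - (g x)\<^sup>2)"
    and g: "(g x)\<^sup>2 \<le> ?Q x" for x
    unfolding coset_deficit_def N[symmetric]
    by (rule positive_part_le[where p="\<lambda>t. coset_prob W C t x" and g="g x"];
        simp add: coset_prob_nonneg sum_coset_prob card_fun_bit g_def)+
  have "1 - avg_error V C \<Lambda> \<le> (\<Sum>x\<in>UNIV. (g x)\<^sup>2)"
    unfolding g_def by (rule success_le[OF assms])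
  then have gap: "(\<Sum>x\<in>UNIV. ?Q x - (g x)\<^sup>2) \<le> avg_error V C \<Lambda>"
    by (simp add: sum_subtractf sum_out_prob)
  moreover have "0 \<le> (\<Sum>x\<in>UNIV. ?Q x - (g x)\<^sup>2)"
    using g by (simp add: sum_nonneg)
  ultimately show "0 \<le> avg_error V C \<Lambda>"
    by simp
  have "(\<Sum>x\<in>UNIV. coset_deficit W C x) \<le> (\<Sum>x\<in>UNIV. sqrt (?Q x) * sqrt (?Q x - (g x)\<^sup>2))"
    by (intro sum_mono le)
  also have "\<dots> \<le> sqrt (avg_error V C \<Lambda>)"
  proof (rule real_le_rsqrt)
    have "(\<Sum>x\<in>UNIV. sqrt (?Q x) * sqrt (?Q x - (g x)\<^sup>2))\<^sup>2 \<le>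
      (\<Sum>x\<in>UNIV. (sqrt (?Q x))\<^sup>2) * (\<Sum>x\<in>UNIV. (sqrt (?Q x - (g x)\<^sup>2))\<^sup>2)"
      by (rule Cauchy_Schwarz_ineq_sum)
    also have "\<dots> \<le> avg_error V C \<Lambda>"
      using gap g by (simp add: out_prob_nonneg sum_out_prob)
    finally show "(\<Sum>x\<in>UNIV. sqrt (?Q x) * sqrt (?Q x - (g x)\<^sup>2))\<^sup>2 \<le> avg_error V C \<Lambda>" .
  qed
  finally show "(\<Sum>x\<in>UNIV. coset_deficit W C x) \<le> sqrt (avg_error V C \<Lambda>)" .
qed

section \<open>Compression with a coset as codebook\<close>

lemma expectation_finite:
  fixes f :: "'a::finite \<Rightarrow> real"
  shows "measure_pmf.expectation p f = (\<Sum>a\<in>UNIV. pmf p a * f a)"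
  by (subst integral_measure_pmf[of UNIV]) auto

lemma pmf_iid_source: "pmf (iid_source p) (x :: 'n::finite \<Rightarrow> 'x) = (\<Prod>i\<in>UNIV. pmf p (x i))"
  by (simp add: iid_source_def pmf_Pi)

lemma symbolwise_distortion_bounds:
  fixes x :: "'n::finite \<Rightarrow> 'x"
  assumes "\<And>x y. 0 \<le> d x y \<and> d x y \<le> 1"
  shows "0 \<le> symbolwise_distortion d x z" and "symbolwise_distortion d x z \<le> 1"
proof -
  show "0 \<le> symbolwise_distortion d x z"
    unfolding symbolwise_distortion_def using assms by (simp add: sum_nonneg)
  have "(\<Sum>i\<in>UNIV. d (x i) (z i)) \<le> of_nat CARD('n) * 1"
    using assms by (intro sum_bounded_above) auto
  then show "symbolwise_distortion d x z \<le> 1"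
    unfolding symbolwise_distortion_def by (simp add: field_simps)
qed

text \<open>In the term of a coordinate \<open>j\<close>, the distortion is absorbed into the factor
  at \<open>j\<close>, and all other factors sum to 1.\<close>

lemma sum_product_symbolwise_distortion:
  fixes J :: "'x::finite \<Rightarrow> 'y::finite \<Rightarrow> real"
  assumes "(\<Sum>x\<in>UNIV. \<Sum>y\<in>UNIV. J x y) = 1"
  shows "(\<Sum>x\<in>UNIV. \<Sum>y\<in>UNIV. (\<Prod>i\<in>UNIV. J (x i) (y i)) *
      symbolwise_distortion d (x :: 'n::finite \<Rightarrow> 'x) y) =
    (\<Sum>x\<in>UNIV. \<Sum>y\<in>UNIV. J x y * d x y)"
proof -
  let ?J = "\<lambda>a. J (fst a) (snd a)" and ?d = "\<lambda>a. d (fst a) (snd a)"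
  have J1: "(\<Sum>a\<in>UNIV. ?J a) = 1"
    using assms by (simp add: sum.cartesian_product case_prod_beta)
  have one: "(\<Sum>f\<in>UNIV. (\<Prod>i\<in>UNIV. ?J (f i)) * ?d (f j)) = (\<Sum>a\<in>UNIV. ?J a * ?d a)" for j :: 'n
  proof -
    have "(\<Prod>i\<in>UNIV. ?J (f i)) * ?d (f j) = (\<Prod>i\<in>UNIV. ?J (f i) * (if i = j then ?d (f i) else 1))" for f
      by (simp add: prod.distrib)
    then have "(\<Sum>f\<in>UNIV. (\<Prod>i\<in>UNIV. ?J (f i)) * ?d (f j)) =
      (\<Prod>i\<in>UNIV. \<Sum>a\<in>UNIV. ?J a * (if i = j then ?d a else 1))"
      by (simp only: sum_fun_prod[where g="\<lambda>i a. ?J a * (if i = j then ?d a else 1)"])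
    also have "\<dots> = (\<Prod>i\<in>UNIV. if i = j then \<Sum>a\<in>UNIV. ?J a * ?d a else 1)"
      by (intro prod.cong) (auto simp: J1)
    finally show ?thesis by simp
  qed
  have "(\<Sum>x\<in>UNIV. \<Sum>y\<in>UNIV. (\<Prod>i\<in>UNIV. J (x i) (y i)) *
      symbolwise_distortion d (x :: 'n \<Rightarrow> 'x) y) =
    (\<Sum>f\<in>UNIV. (\<Prod>i\<in>UNIV. ?J (f i)) * (1 / real CARD('n) * (\<Sum>j\<in>UNIV. ?d ((f :: 'n \<Rightarrow> 'x \<times> 'y) j))))"
    unfolding symbolwise_distortion_def sum_fun_pair[symmetric] by simp
  also have "\<dots> = 1 / real CARD('n) * (\<Sum>j\<in>UNIV. \<Sum>f\<in>UNIV. (\<Prod>i\<in>UNIV. ?J (f i)) * ?d ((f :: 'n \<Rightarrow> 'x \<times> 'y) j))"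
    by (subst sum.swap) (simp add: sum_distrib_left mult_ac)
  also have "\<dots> = (\<Sum>a\<in>UNIV. ?J a * ?d a)"
    by (simp only: one) simp
  also have "\<dots> = (\<Sum>x\<in>UNIV. \<Sum>y\<in>UNIV. J x y * d x y)"
    by (simp add: sum.cartesian_product case_prod_beta)
  finally show ?thesis .
qed

text \<open>The encoder sends the index of a nearest element of \<open>S\<close> in a fixed
  enumeration.\<close>

lemma scheme_of_finite_codebook:
  fixes p :: "'a::finite pmf" and d :: "'a \<Rightarrow> 'b \<Rightarrow> real" and S :: "'b set"
  assumes S: "finite S" "S \<noteq> {}"
    and le: "(\<Sum>x\<in>UNIV. pmf p x * Min (d x ` S)) \<le> D\<^sub>0"
  shows "\<exists>(M :: nat set) E D. lossy_compression_scheme p d (log 2 (card S)) D\<^sub>0 M E D"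
proof -
  obtain h where h: "bij_betw h {0..<card S} S"
    using ex_bij_betw_nat_finite[OF S(1)] by blast
  have "\<exists>m\<in>{0..<card S}. d x (h m) = Min (d x ` S)" for x
  proof -
    have "Min (d x ` S) \<in> d x ` S"
      using S by (intro Min_in) auto
    then obtain y where "y \<in> S" "d x y = Min (d x ` S)"
      by (metis imageE)
    then show ?thesis
      using bij_betw_imp_surj_on[OF h] by (metis imageE)
  qed
  then obtain E where E: "\<And>x. E x \<in> {0..<card S}" "\<And>x. d x (h (E x)) = Min (d x ` S)"
    by metis
  have "lossy_compression_scheme p d (log 2 (card S)) D\<^sub>0 {0..<card S} E h"
    using E le unfolding lossy_compression_scheme_def by (auto simp: expectation_finite)
  then show ?thesis by blast
qed

lemma log_card_dual_coset:
  fixes C :: "(bit ^ 'n::finite) set"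
  assumes "vec.subspace C"
  shows "log 2 (real (card (dual_coset C t))) = real CARD('n) - log 2 (real (card C))"
proof -
  let ?K = "card (dual_coset C (\<lambda>_. 0))"
  have eq: "real ?K * real (card C) = 2 ^ CARD('n)"
    using card_dual_code[OF assms] by (metis of_nat_mult of_nat_numeral of_nat_power)
  then have "real ?K \<noteq> 0" "real (card C) \<noteq> 0"
    by auto
  then have "log 2 (real ?K) + log 2 (real (card C)) = log 2 (2 ^ CARD('n))"
    unfolding eq[symmetric] by (simp add: log_mult)
  then show ?thesis
    by (subst card_dual_coset) (simp add: log_nat_power)
qed

section \<open>The action of the channel symmetry on words\<close>

definition flip :: "('x \<Rightarrow> 'x) \<Rightarrow> ('n \<Rightarrow> bit) \<Rightarrow> ('n \<Rightarrow> 'x) \<Rightarrow> 'n \<Rightarrow> 'x" where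
  "flip \<pi> u x = (\<lambda>i. if u i = 1 then \<pi> (x i) else x i)"

locale symmetric_setting =
  fixes W :: "bit \<Rightarrow> 'x::finite pmf" and \<pi> :: "'x \<Rightarrow> 'x"
  assumes inv: "\<pi> (\<pi> x) = x"
    and sym: "pmf (W (z + 1)) (\<pi> x) = pmf (W z) x"
begin

lemma pmf_flip: "pmf (W z) (if u = 1 then \<pi> x else x) = pmf (W (z + u)) x"
  using sym[of "z + 1" x] by (cases u) auto

lemma sum_flip: "(\<Sum>x\<in>UNIV. f (flip \<pi> u x)) = (\<Sum>x\<in>UNIV. f (x :: 'n::finite \<Rightarrow> 'x))"
  by (rule sum.reindex_bij_witness[of _ "flip \<pi> u" "flip \<pi> u"]) (auto simp: flip_def inv)

lemma block_prob_flip: "block_prob W z (flip \<pi> u x) = block_prob W (bit_shift u z) x"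
  by (simp add: block_prob_def flip_def pmf_flip bit_shift_def)

lemma out_prob_flip: "out_prob W (flip \<pi> u x) = out_prob W x"
  unfolding out_prob_def flip_def pmf_flip
proof (intro prod.cong refl)
  fix i
  show "(pmf (W (0 + u i)) (x i) + pmf (W (1 + u i)) (x i)) / 2 = (pmf (W 0) (x i) + pmf (W 1) (x i)) / 2"
    by (cases "u i") auto
qed

text \<open>Flipping the output by \<open>u\<close> amounts to shifting the input by
  \<open>u\<close>, which carries cosets to cosets.\<close>

lemma coset_prob_flip: "coset_prob W C t (flip \<pi> u x) = coset_prob W C (bit_shift u t) x"
  unfolding coset_prob_def block_prob_flip
  using sum.reindex_bij_betw[OF bij_betw_shift_dual_coset[of u C t], of "\<lambda>z. block_prob W z x"]
    bij_betw_same_card[OF bij_betw_shift_dual_coset[of u C t]] by simp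

text \<open>The deficit averages over all cosets, so permuting them leaves it unchanged.\<close>

lemma coset_deficit_flip: "coset_deficit W C (flip \<pi> u x) = coset_deficit W C x"
  unfolding coset_deficit_def out_prob_flip coset_prob_flip
  by (subst sum_shift[of "\<lambda>t. max 0 (out_prob W x - coset_prob W C t x)" u]) (rule refl)

text \<open>Averaging over all flips turns the source distribution into the output distribution of the
  uniform input, whatever the input distribution \<open>p\<close> is.\<close>

lemma sum_source_flip_invariant:
  fixes h :: "('n::finite \<Rightarrow> 'x) \<Rightarrow> real"
  assumes h: "\<And>u x. h (flip \<pi> u x) = h x"
    and P: "\<And>x. pmf P\<^sub>X x = p 0 * pmf (W 0) x + p 1 * pmf (W 1) x" and p: "p 0 + p 1 = (1 :: real)"
  shows "(\<Sum>x\<in>UNIV. pmf (iid_source P\<^sub>X) x * h x) = (\<Sum>x\<in>UNIV. out_prob W x * h x)"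
proof -
  let ?N = "2 ^ CARD('n) :: real"
  have avg: "(\<Sum>u\<in>UNIV. pmf (iid_source P\<^sub>X) (flip \<pi> u x)) = ?N * out_prob W x" for x :: "'n \<Rightarrow> 'x"
  proof -
    have "(\<Sum>u\<in>UNIV. pmf (iid_source P\<^sub>X) (flip \<pi> u x)) =
      (\<Prod>i\<in>UNIV. \<Sum>a\<in>(UNIV :: bit set). pmf P\<^sub>X (if a = 1 then \<pi> (x i) else x i))"
      unfolding pmf_iid_source flip_def
      by (rule sum_fun_prod[where g="\<lambda>i (a :: bit). pmf P\<^sub>X (if a = 1 then \<pi> (x i) else x i)"])
    also have "\<dots> = (\<Prod>i\<in>UNIV. pmf (W 0) (x i) + pmf (W 1) (x i))"
    proof (intro prod.cong refl)
      fix i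
      \<comment> \<open>The involution exchanges the two output distributions, so in the sum over a
        letter and its image each gets the weight \<open>p 0 + p 1\<close>.\<close>
      have "pmf P\<^sub>X (x i) + pmf P\<^sub>X (\<pi> (x i)) = (p 0 + p 1) * (pmf (W 0) (x i) + pmf (W 1) (x i))"
        using sym[of 0 "x i"] sym[of 1 "x i"] by (simp add: P algebra_simps)
      then show "(\<Sum>a\<in>(UNIV :: bit set). pmf P\<^sub>X (if a = 1 then \<pi> (x i) else x i)) = pmf (W 0) (x i) + pmf (W 1) (x i)"
        by (simp add: UNIV_bit p)
    qed
    finally show ?thesis
      by (simp add: out_prob_def prod_dividef)
  qed
  have "?N * (\<Sum>x\<in>UNIV. pmf (iid_source P\<^sub>X) x * h x) =
    (\<Sum>u\<in>UNIV. \<Sum>x\<in>UNIV. pmf (iid_source P\<^sub>X) (flip \<pi> u x) * h (flip \<pi> u x))"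
    by (subst sum_flip) (simp add: card_fun_bit)
  also have "\<dots> = (\<Sum>x\<in>UNIV. (\<Sum>u\<in>UNIV. pmf (iid_source P\<^sub>X) (flip \<pi> u x)) * h x)"
    unfolding h sum_distrib_right by (rule sum.swap)
  also have "\<dots> = ?N * (\<Sum>x\<in>UNIV. out_prob W x * h x)"
    unfolding avg by (simp add: sum_distrib_left mult_ac)
  finally show ?thesis by simp
qed

end

text \<open>The expected distortion when a source letter is reconstructed by a sample from the
  posterior for a uniform input.\<close>

definition posterior_distortion ::
  "(bit \<Rightarrow> 'x::finite pmf) \<Rightarrow> 'x pmf \<Rightarrow> ('x \<Rightarrow> bit \<Rightarrow> real) \<Rightarrow> real" where
  "posterior_distortion W P\<^sub>X d =
    (\<Sum>x\<in>UNIV. \<Sum>z\<in>UNIV. pmf P\<^sub>X x * (pmf (W z) x / (pmf (W 0) x + pmf (W 1) x)) * d x z)"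

text \<open>The best element of a coset is no worse than a posterior sample within it. Changing the
  weight from \<open>coset_prob\<close> to \<open>out_prob\<close> costs at most the positive part
  of their difference, as the minima lie between 0 and 1.\<close>

lemma coset_distortion_le:
  fixes W :: "bit \<Rightarrow> 'x pmf" and x :: "'n::finite \<Rightarrow> 'x" and C :: "(bit ^ 'n) set"
    and \<Delta> :: "('n \<Rightarrow> bit) \<Rightarrow> real"
  assumes \<Delta>: "\<And>z. 0 \<le> \<Delta> z" "\<And>z. \<Delta> z \<le> 1"
  shows "out_prob W x * (\<Sum>t\<in>UNIV. Min (\<Delta> ` dual_coset C t)) / 2 ^ CARD('n) \<le>
    (\<Sum>z\<in>UNIV. block_prob W z x * \<Delta> z) / 2 ^ CARD('n) + coset_deficit W C x"
proof -
  let ?m = "\<lambda>t. Min (\<Delta> ` dual_coset C t)" and ?Q = "out_prob W x" and ?P = "\<lambda>t. coset_prob W C t x"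
  have m_le: "?m t \<le> \<Delta> z" if "z \<in> dual_coset C t" for t z
    using that by simp
  have m: "0 \<le> ?m t" "?m t \<le> 1" for t
    using order_trans[OF m_le[OF mem_dual_coset_self] \<Delta>(2)] \<Delta>(1) by auto
  have Pm: "?P t * ?m t \<le> (\<Sum>z\<in>dual_coset C t. block_prob W z x * \<Delta> z) / card (dual_coset C t)" for t
    unfolding coset_prob_def times_divide_eq_left sum_distrib_right
    by (intro divide_right_mono sum_mono mult_left_mono m_le) (auto simp: block_prob_nonneg)
  have "?Q * ?m t \<le> (\<Sum>z\<in>dual_coset C t. block_prob W z x * \<Delta> z) / card (dual_coset C t) + max 0 (?Q - ?P t)" for t
  proof -
    have "(?Q - ?P t) * ?m t \<le> max 0 (?Q - ?P t) * ?m t"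
      using m by (intro mult_right_mono) auto
    also have "\<dots> \<le> max 0 (?Q - ?P t)"
      using m by (intro mult_left_le) auto
    finally show ?thesis
      using Pm[of t] by (simp add: algebra_simps)
  qed
  then have "(\<Sum>t\<in>UNIV. ?Q * ?m t) \<le> (\<Sum>t\<in>UNIV. (\<Sum>z\<in>dual_coset C t. block_prob W z x * \<Delta> z) /
    card (dual_coset C t) + max 0 (?Q - ?P t))"
    by (intro sum_mono)
  also have "\<dots> = (\<Sum>z\<in>UNIV. block_prob W z x * \<Delta> z) + (\<Sum>t\<in>UNIV. max 0 (?Q - ?P t))"
    unfolding sum.distrib sum_coset_average ..
  finally show ?thesis
    unfolding coset_deficit_def add_divide_distrib[symmetric] sum_distrib_left[symmetric]
    by (intro divide_right_mono) auto
qed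

text \<open>The bound holds on average over \<open>t\<close>, hence for some \<open>t\<close>.
  Weighting \<open>coset_distortion_le\<close> by the source probability over
  \<open>out_prob\<close> leaves the posterior distortion and a term in \<open>coset_deficit\<close>
  over \<open>out_prob\<close>. The latter quotient is invariant under flips, so there the source
  can be exchanged.\<close>

lemma (in symmetric_setting) exists_good_coset:
  fixes V :: "bit \<Rightarrow> complex ^ (bit \<times> 'd::finite) ^ (bit \<times> 'd)" and C :: "(bit ^ 'n::finite) set"
    and d :: "'x \<Rightarrow> bit \<Rightarrow> real"
  assumes d: "\<And>x z. 0 \<le> d x z \<and> d x z \<le> 1"
    and P: "\<And>x. pmf P\<^sub>X x = p 0 * pmf (W 0) x + p 1 * pmf (W 1) x" and p: "p 0 + p 1 = (1 :: real)"
    and code: "dual_channel W V" "vec.subspace C" "povm C \<Lambda>"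
  shows "\<exists>t. (\<Sum>x\<in>UNIV. pmf (iid_source P\<^sub>X) x * Min (symbolwise_distortion d x ` dual_coset C t)) \<le>
    posterior_distortion W P\<^sub>X d + sqrt (avg_error V C \<Lambda>)" (is "\<exists>t. ?L t \<le> ?R")
proof -
  let ?N = "2 ^ CARD('n) :: real"
  let ?Q = "out_prob W :: ('n \<Rightarrow> 'x) \<Rightarrow> real" and ?P = "pmf (iid_source P\<^sub>X) :: ('n \<Rightarrow> 'x) \<Rightarrow> real"
  let ?m = "\<lambda>x t. Min (symbolwise_distortion d x ` dual_coset C t)"
  let ?J = "\<lambda>x z. pmf P\<^sub>X x * (pmf (W z) x / (pmf (W 0) x + pmf (W 1) x))"
  have P0: "pmf P\<^sub>X x = 0" if "pmf (W 0) x + pmf (W 1) x = 0" for x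
    using that P[of x] by (simp add: add_nonneg_eq_0_iff)
  \<comment> \<open>Division by zero does no harm: where the output probability vanishes, so does
    the source probability.\<close>
  have PQ: "?P x / ?Q x * ?Q x = ?P x" for x
  proof (cases "?Q x = 0")
    case True
    then obtain i where "pmf (W 0) (x i) + pmf (W 1) (x i) = 0"
      by (auto simp: out_prob_def)
    then have "?P x = 0"
      using P0 by (auto simp: pmf_iid_source)
    then show ?thesis by simp
  qed simp
  have J1: "(\<Sum>x\<in>UNIV. \<Sum>z\<in>UNIV. ?J x z) = 1"
  proof -
    have "(\<Sum>z\<in>UNIV. ?J x z) = pmf P\<^sub>X x" for x
      using P0[of x] by (cases "pmf (W 0) x + pmf (W 1) x = 0")
        (auto simp: UNIV_bit distrib_left[symmetric] add_divide_distrib[symmetric])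
    then show ?thesis by (simp add: sum_pmf_eq_1)
  qed
  \<comment> \<open>The factor \<open>?N\<close> cancels the halves in \<open>out_prob\<close>, and
    a product of single-letter posteriors remains.\<close>
  have ideal: "?P x / ?Q x * ((\<Sum>z\<in>UNIV. block_prob W z x * f z) / ?N) =
    (\<Sum>z\<in>UNIV. (\<Prod>i\<in>UNIV. ?J (x i) (z i)) * f z)" for x f
    by (simp add: sum_distrib_left sum_divide_distrib pmf_iid_source out_prob_def block_prob_def
        prod_dividef prod.distrib mult.assoc)
  have "(\<Sum>t\<in>UNIV. ?L t) / ?N = (\<Sum>x\<in>UNIV. ?P x / ?Q x * (?Q x * (\<Sum>t\<in>UNIV. ?m x t) / ?N))"
    unfolding times_divide_eq_right mult.assoc[symmetric]
    unfolding times_divide_eq_right[symmetric] PQ sum_divide_distrib[symmetric]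
    by (subst sum.swap) (simp add: sum_distrib_left sum_divide_distrib)
  also have "\<dots> \<le> (\<Sum>x\<in>UNIV. ?P x / ?Q x *
      ((\<Sum>z\<in>UNIV. block_prob W z x * symbolwise_distortion d x z) / ?N + coset_deficit W C x))"
    using d by (intro sum_mono mult_left_mono coset_distortion_le)
      (auto simp: symbolwise_distortion_bounds out_prob_nonneg)
  also have "\<dots> = (\<Sum>x\<in>UNIV. \<Sum>z\<in>UNIV. (\<Prod>i\<in>UNIV. ?J (x i) (z i)) * symbolwise_distortion d (x :: 'n \<Rightarrow> 'x) z) +
      (\<Sum>x\<in>UNIV. ?P x * (coset_deficit W C x / ?Q x))"
    unfolding distrib_left sum.distrib ideal by simp
  also have "(\<Sum>x\<in>UNIV. \<Sum>z\<in>UNIV. (\<Prod>i\<in>UNIV. ?J (x i) (z i)) * symbolwise_distortion d (x :: 'n \<Rightarrow> 'x) z) =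
      posterior_distortion W P\<^sub>X d"
    unfolding posterior_distortion_def by (rule sum_product_symbolwise_distortion[OF J1])
  also have "(\<Sum>x\<in>UNIV. ?P x * (coset_deficit W C x / ?Q x)) =
      (\<Sum>x\<in>UNIV. ?Q x * (coset_deficit W C x / ?Q x))"
    by (rule sum_source_flip_invariant[OF _ P p]) (simp add: coset_deficit_flip out_prob_flip)
  also have "\<dots> \<le> (\<Sum>x\<in>UNIV. coset_deficit W C x)"
    by (intro sum_mono) (auto simp: coset_deficit_def sum_nonneg)
  also have "\<dots> \<le> sqrt (avg_error V C \<Lambda>)"
    by (rule sum_coset_deficit_le[OF code])
  finally have "(\<Sum>t\<in>UNIV. ?L t) \<le> ?N * ?R"
    by (simp add: field_simps)
  also have "\<dots> = (\<Sum>t\<in>(UNIV :: ('n \<Rightarrow> bit) set). ?R)"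
    by (simp add: card_fun_bit)
  finally show ?thesis
    by (meson not_le sum_strict_mono finite UNIV_not_empty)
qed

section \<open>Mutual information and relative entropy\<close>

lemma ex_pmf_of_fun:
  fixes f :: "'a::finite \<Rightarrow> real"
  assumes "\<And>x. 0 \<le> f x" and "(\<Sum>x\<in>UNIV. f x) = 1"
  shows "\<exists>p. \<forall>x. pmf p x = f x"
proof -
  have "(\<integral>\<^sup>+x. ennreal (f x) \<partial>count_space UNIV) = 1"
    using assms by (subst nn_integral_count_space_finite) (auto simp: sum_ennreal)
  then show ?thesis
    using pmf_embed_pmf[of f] assms(1) by blast
qed

lemma pmf_map_fst: "pmf (map_pmf fst P) x = (\<Sum>y\<in>UNIV. pmf P (x, y :: 'b::finite))"
proof -
  have "fst -` {x} = range (Pair x :: 'b \<Rightarrow> _)"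
    by auto
  then have "pmf (map_pmf fst P) x = (\<Sum>a\<in>range (Pair x :: 'b \<Rightarrow> _). pmf P a)"
    by (simp add: pmf_map measure_measure_pmf_finite)
  then show ?thesis
    by (simp add: sum.reindex inj_on_def)
qed

lemma pmf_map_snd: "pmf (map_pmf snd P) y = (\<Sum>x\<in>UNIV. pmf P (x :: 'a::finite, y))"
proof -
  have "snd -` {y} = range (\<lambda>x :: 'a. (x, y))"
    by auto
  then have "pmf (map_pmf snd P) y = (\<Sum>a\<in>range (\<lambda>x :: 'a. (x, y)). pmf P a)"
    by (simp add: pmf_map measure_measure_pmf_finite)
  then show ?thesis
    by (simp add: sum.reindex inj_on_def)
qed

lemma mutual_info_eq_sum:
  fixes P :: "('a::finite \<times> 'b::finite) pmf"
  shows "mutual_info P = (\<Sum>a\<in>UNIV. pmf P a *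
    log 2 (pmf P a / (pmf (map_pmf fst P) (fst a) * pmf (map_pmf snd P) (snd a))))"
proof -
  interpret information_space "measure_pmf P" 2
    by unfold_locales auto
  have pair: "count_space (UNIV :: 'a set) \<Otimes>\<^sub>M count_space (UNIV :: 'b set) = count_space UNIV"
    by (simp add: pair_measure_count_space)
  have dist: "distributed (measure_pmf P) (count_space UNIV) f (pmf (map_pmf f P))" for f :: "'a \<times> 'b \<Rightarrow> 'c"
    unfolding distributed_def
    by (simp add: map_pmf_rep_eq[symmetric] measure_pmf_eq_density[symmetric] comp_def)
  have "mutual_info P = (\<integral>a. pmf P a *
      log 2 (pmf P a / (pmf (map_pmf fst P) (fst a) * pmf (map_pmf snd P) (snd a)))
      \<partial>(count_space UNIV \<Otimes>\<^sub>M count_space UNIV))"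
    unfolding mutual_info_def
    using dist[of fst] dist[of snd] dist[of id]
    by (intro mutual_information_distr)
      (auto simp: sigma_finite_measure_count_space_finite pair id_def)
  also have "\<dots> = (\<Sum>a\<in>UNIV. pmf P a *
      log 2 (pmf P a / (pmf (map_pmf fst P) (fst a) * pmf (map_pmf snd P) (snd a))))"
    unfolding pair by (simp add: lebesgue_integral_count_space_finite)
  finally show ?thesis .
qed

text \<open>Relative entropy in nats, whence the factor \<open>ln 2\<close> in comparisons with
  \<open>mutual_info\<close>.\<close>

definition kl :: "('a \<Rightarrow> real) \<Rightarrow> ('a \<Rightarrow> real) \<Rightarrow> real" where
  "kl f g = (\<Sum>a\<in>UNIV. f a * ln (f a / g a))"

text \<open>The tangent bound \<open>ln s \<le> s - 1\<close> at \<open>s = v / u\<close>, with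
  equality only at 1.\<close>

lemma kl_term_ge:
  fixes u v :: real
  assumes "0 \<le> u" "0 \<le> v" "0 < u \<Longrightarrow> 0 < v"
  shows "u - v \<le> u * ln (u / v)" and "u * ln (u / v) = u - v \<Longrightarrow> u = v"
proof -
  have *: "u * ln (u / v) = - u * ln (v / u)" if "u > 0"
    using that assms by (simp add: ln_div algebra_simps)
  show "u - v \<le> u * ln (u / v)"
  proof (cases "u = 0")
    case False
    then have u: "u > 0" "v > 0" using assms by auto
    then have "u * ln (v / u) \<le> u * (v / u - 1)"
      by (intro mult_left_mono ln_le_minus_one) auto
    then show ?thesis
      using u by (simp add: * algebra_simps)
  qed (use assms in auto)
  show "u = v" if "u * ln (u / v) = u - v"
  proof (cases "u = 0")
    case False
    then have u: "u > 0" "v > 0" using assms by auto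
    then have "ln (v / u) = v / u - 1"
      using that by (simp add: * field_simps)
    then have "v / u = 1"
      using u by (intro ln_eq_minus_one) auto
    then show ?thesis using u by simp
  qed (use that in auto)
qed

text \<open>Gibbs' inequality: as the totals agree, \<open>f a - g a\<close> can be subtracted from
  each term, which makes all terms nonnegative.\<close>

lemma kl_nonneg:
  fixes f g :: "'a::finite \<Rightarrow> real"
  assumes f: "\<And>a. 0 \<le> f a" and g: "\<And>a. 0 \<le> g a" and fg: "\<And>a. 0 < f a \<Longrightarrow> 0 < g a"
    and s: "sum f UNIV = sum g UNIV"
  shows "0 \<le> kl f g" and "kl f g = 0 \<Longrightarrow> f = g"
proof -
  have le: "0 \<le> f a * ln (f a / g a) - (f a - g a)" for a
    using kl_term_ge(1)[OF f g fg, of a a] by simp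
  have eq: "kl f g = (\<Sum>a\<in>UNIV. f a * ln (f a / g a) - (f a - g a))"
    by (simp add: kl_def sum_subtractf s)
  show "0 \<le> kl f g"
    unfolding eq by (intro sum_nonneg le)
  assume "kl f g = 0"
  then have "f a * ln (f a / g a) - (f a - g a) = 0" for a
    unfolding eq using le by (simp add: sum_nonneg_eq_0_iff)
  then show "f = g"
    using kl_term_ge(2)[OF f g fg] by fastforce
qed

text \<open>Convexity in the first argument, with \<open>g\<close> as the second point, where the
  relative entropy vanishes. The linear terms of the two tangent bounds \<open>1\<close> and
  \<open>2\<close> cancel.\<close>

lemma kl_mix_le:
  fixes f g :: "'a::finite \<Rightarrow> real"
  assumes f: "\<And>a. 0 \<le> f a" and g: "\<And>a. 0 \<le> g a" and fg: "\<And>a. 0 < f a \<Longrightarrow> 0 < g a"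
    and r: "0 < r" "r \<le> 1"
  shows "kl (\<lambda>a. (1 - r) * f a + r * g a) g \<le> (1 - r) * kl f g"
  unfolding kl_def sum_distrib_left
proof (intro sum_mono)
  fix a
  let ?w = "(1 - r) * f a + r * g a"
  show "?w * ln (?w / g a) \<le> (1 - r) * (f a * ln (f a / g a))"
  proof (cases "g a = 0")
    case True
    then have "f a = 0" using f[of a] fg[of a] by fastforce
    then show ?thesis using True by simp
  next
    case False
    then have ga: "g a > 0" using g[of a] by simp
    have w: "?w > 0" using r f[of a] ga by (intro add_nonneg_pos) auto
    have 1: "g a * ln (?w / g a) \<le> ?w - g a"
      using kl_term_ge(1)[of "g a" ?w] ga w by (simp add: ln_div algebra_simps)
    have 2: "f a * ln (?w / g a) + (f a - ?w) \<le> f a * ln (f a / g a)"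
    proof (cases "f a = 0")
      case False
      then have "f a > 0" using f[of a] by simp
      then have "f a * ln (f a / g a) = f a * ln (f a / ?w) + f a * ln (?w / g a)"
        using w ga by (simp add: ln_div algebra_simps)
      then show ?thesis
        using kl_term_ge(1)[of "f a" ?w] f[of a] w by simp
    qed (use w in auto)
    have "?w * ln (?w / g a) = (1 - r) * (f a * ln (?w / g a)) + r * (g a * ln (?w / g a))"
      by (simp only: distrib_right mult.assoc)
    also have "\<dots> \<le> (1 - r) * (f a * ln (f a / g a) - (f a - ?w)) + r * (?w - g a)"
      using 1 2 r by (intro add_mono mult_left_mono) auto
    also have "\<dots> = (1 - r) * (f a * ln (f a / g a))"
      by (simp add: algebra_simps)
    finally show ?thesis .
  qed
qed

text \<open>Where \<open>f a + h a\<close> is positive, \<open>ln (1 + h a / f a)\<close> is at most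
  \<open>h a / f a\<close>. The first-order terms vanish in total by \<open>sh\<close> and
  \<open>flat\<close>, and a quadratic remainder stays.\<close>

lemma kl_perturb_le:
  fixes f g h :: "'a::finite \<Rightarrow> real"
  assumes f: "\<And>a. 0 \<le> f a" and h: "\<And>a. 0 \<le> f a + h a" and fg: "\<And>a. 0 < f a \<Longrightarrow> 0 < g a"
    and h0: "\<And>a. f a = 0 \<Longrightarrow> h a = 0" and sh: "sum h UNIV = 0"
    and flat: "(\<Sum>a\<in>UNIV. h a * ln (f a / g a)) = 0"
  shows "kl (\<lambda>a. f a + h a) g \<le> kl f g + (\<Sum>a\<in>UNIV. (h a)\<^sup>2 / f a)"
proof -
  have "kl (\<lambda>a. f a + h a) g \<le> (\<Sum>a\<in>UNIV. f a * ln (f a / g a) + h a * ln (f a / g a) + h a + (h a)\<^sup>2 / f a)"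
    unfolding kl_def
  proof (intro sum_mono)
    fix a
    show "(f a + h a) * ln ((f a + h a) / g a) \<le> f a * ln (f a / g a) + h a * ln (f a / g a) + h a + (h a)\<^sup>2 / f a"
    proof (cases "f a = 0")
      case False
      then have fa: "f a > 0" "g a > 0" using f[of a] fg[of a] by auto
      have rhs: "f a * ln (f a / g a) + h a * ln (f a / g a) + h a + (h a)\<^sup>2 / f a =
        (f a + h a) * (ln (f a / g a) + h a / f a)"
        using fa by (simp add: field_simps power2_eq_square)
      show ?thesis
      proof (cases "f a + h a = 0")
        case nz: False
        then have u: "f a + h a > 0" using h[of a] by simp
        have "ln ((f a + h a) / g a) = ln (f a / g a) + ln ((f a + h a) / f a)"
          using u fa by (simp add: ln_div)
        also have "ln ((f a + h a) / f a) \<le> (f a + h a) / f a - 1"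
          using u fa by (intro ln_le_minus_one) auto
        also have "(f a + h a) / f a - 1 = h a / f a"
          using fa by (simp add: field_simps)
        finally show ?thesis
          unfolding rhs using u by (intro mult_left_mono) auto
      qed (simp add: rhs)
    qed (simp add: h0)
  qed
  then show ?thesis
    by (simp add: sum.distrib sh flat kl_def)
qed

text \<open>The excess in the last bound is \<open>kl \<nu> q\<close>, so a fixed \<open>q\<close>
  may stand in for the true second marginal when the mutual information is bounded from
  above.\<close>

lemma
  fixes P :: "('a::finite \<times> 'b::finite) pmf"
  defines "\<mu> \<equiv> pmf (map_pmf fst P)" and "\<nu> \<equiv> pmf (map_pmf snd P)"
  shows mutual_info_eq_kl: "ln 2 * mutual_info P = kl (pmf P) (\<lambda>a. \<mu> (fst a) * \<nu> (snd a))"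
    and mutual_info_nonneg: "0 \<le> mutual_info P"
    and mutual_info_eq_0D: "mutual_info P = 0 \<Longrightarrow> pmf P (x, y) = \<mu> x * \<nu> y"
    and mutual_info_le_kl: "(\<And>y. 0 < q y) \<Longrightarrow> sum q UNIV = 1 \<Longrightarrow>
      ln 2 * mutual_info P \<le> kl (pmf P) (\<lambda>a. \<mu> (fst a) * q (snd a))"
proof -
  let ?g = "\<lambda>a. \<mu> (fst a) * \<nu> (snd a)"
  have le: "pmf P (x, y) \<le> \<mu> x" "pmf P (x, y) \<le> \<nu> y" for x y
    unfolding \<mu>_def \<nu>_def pmf_map_fst pmf_map_snd
    using member_le_sum[of y UNIV "\<lambda>y. pmf P (x, y)"] member_le_sum[of x UNIV "\<lambda>x. pmf P (x, y)"] by auto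
  have pos: "0 < \<mu> (fst a)" "0 < \<nu> (snd a)" if "0 < pmf P a" for a
    using le[of "fst a" "snd a"] that by auto
  have nonneg: "0 \<le> \<mu> x" "0 \<le> \<nu> y" for x y
    by (simp_all add: \<mu>_def \<nu>_def)
  have "(\<Sum>a\<in>UNIV. ?g a) = (\<Sum>x\<in>UNIV. \<Sum>y\<in>UNIV. \<mu> x * \<nu> y)"
    by (simp add: sum.cartesian_product case_prod_beta)
  then have sg: "sum (pmf P) UNIV = sum ?g UNIV"
    by (simp add: sum_distrib_left[symmetric] \<mu>_def \<nu>_def sum_pmf_eq_1)
  show eq: "ln 2 * mutual_info P = kl (pmf P) ?g"
    unfolding mutual_info_eq_sum kl_def sum_distrib_left \<mu>_def \<nu>_def log_def
    by (intro sum.cong) auto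
  have "0 \<le> kl (pmf P) ?g" and kl0: "kl (pmf P) ?g = 0 \<Longrightarrow> pmf P = ?g"
    by (rule kl_nonneg; use nonneg pos sg in simp)+
  then show "0 \<le> mutual_info P"
    unfolding eq[symmetric] by (simp add: zero_le_mult_iff)
  show "pmf P (x, y) = \<mu> x * \<nu> y" if "mutual_info P = 0"
    using kl0 that eq by (metis mult_zero_right fst_conv snd_conv)
  assume q: "\<And>y. 0 < q y" "sum q UNIV = 1"
  have "kl (pmf P) (\<lambda>a. \<mu> (fst a) * q (snd a)) - kl (pmf P) ?g =
    (\<Sum>a\<in>UNIV. pmf P a * ln (\<nu> (snd a) / q (snd a)))"
    unfolding kl_def sum_subtractf[symmetric]
  proof (intro sum.cong refl)
    fix a
    show "pmf P a * ln (pmf P a / (\<mu> (fst a) * q (snd a))) - pmf P a * ln (pmf P a / ?g a) =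
      pmf P a * ln (\<nu> (snd a) / q (snd a))"
    proof (cases "pmf P a = 0")
      case False
      then have "pmf P a > 0" by simp
      then show ?thesis
        using pos[of a] q(1)[of "snd a"] by (simp add: ln_div ln_mult algebra_simps)
    qed simp
  qed
  also have "\<dots> = (\<Sum>x\<in>UNIV. \<Sum>y\<in>UNIV. pmf P (x, y) * ln (\<nu> y / q y))"
    by (simp add: sum.cartesian_product case_prod_beta)
  also have "\<dots> = kl \<nu> q"
    unfolding kl_def \<nu>_def pmf_map_snd by (subst sum.swap) (simp add: sum_distrib_right)
  also have "kl \<nu> q \<ge> 0"
    using q nonneg by (intro kl_nonneg) (auto simp: \<nu>_def sum_pmf_eq_1 less_imp_le)
  finally show "ln 2 * mutual_info P \<le> kl (pmf P) (\<lambda>a. \<mu> (fst a) * q (snd a))"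
    unfolding eq by simp
qed

text \<open>Mutual information is bounded below by 0, without which the real infimum need not be a
  lower bound.\<close>

lemma optimal_joint_le:
  fixes P :: "('a::finite \<times> 'b::finite) pmf"
  assumes "optimal_joint PX d \<delta> P" and "admissible_joint PX d \<delta> P'"
  shows "mutual_info P \<le> mutual_info P'"
proof -
  have "bdd_below (mutual_info ` {P. admissible_joint PX d \<delta> P})"
    by (rule bdd_belowI2[of _ 0]) (rule mutual_info_nonneg)
  then show ?thesis
    using assms unfolding optimal_joint_def rate_distortion_def by (auto intro: cINF_lower)
qed

section \<open>The distortion of the posterior for the uniform input\<close>

text \<open>Half the harmonic mean of the two likelihoods.\<close>

definition overlap :: "(bit \<Rightarrow> 'x pmf) \<Rightarrow> 'x \<Rightarrow> real" where
  "overlap W x = pmf (W 0) x * pmf (W 1) x / (pmf (W 0) x + pmf (W 1) x)"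

lemma overlap_nonneg: "0 \<le> overlap W x"
  by (simp add: overlap_def)

lemma overlap_le: "overlap W x \<le> pmf (W z) x"
proof (cases "pmf (W 0) x + pmf (W 1) x = 0")
  case False
  then have "pmf (W 0) x + pmf (W 1) x > 0"
    by (simp add: less_le)
  then show ?thesis
    by (cases z) (auto simp: overlap_def field_simps)
qed (simp add: overlap_def)

text \<open>For each \<open>x\<close>, passing from the weights \<open>p z * pmf (W z) x\<close> to
  the posterior ones moves \<open>(p 1 - p 0) * overlap W x\<close> from \<open>z = 1\<close> to
  \<open>z = 0\<close>.\<close>

lemma posterior_distortion_eq:
  fixes W :: "bit \<Rightarrow> 'x::finite pmf" and p :: "bit \<Rightarrow> real"
  assumes P: "\<And>x. pmf P\<^sub>X x = p 0 * pmf (W 0) x + p 1 * pmf (W 1) x" and p: "p 0 + p 1 = 1"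
  shows "posterior_distortion W P\<^sub>X d = (\<Sum>x\<in>UNIV. \<Sum>z\<in>UNIV. p z * pmf (W z) x * d x z) +
    (p 1 - p 0) * (\<Sum>x\<in>UNIV. overlap W x * (d x 0 - d x 1))"
  unfolding posterior_distortion_def sum_distrib_left sum.distrib[symmetric]
proof (intro sum.cong refl)
  fix x
  let ?a = "pmf (W 0) x" and ?b = "pmf (W 1) x"
  have q: "p 1 = 1 - p 0" using p by simp
  show "(\<Sum>z\<in>UNIV. pmf P\<^sub>X x * (pmf (W z) x / (?a + ?b)) * d x z) =
    (\<Sum>z\<in>UNIV. p z * pmf (W z) x * d x z) + (p 1 - p 0) * (overlap W x * (d x 0 - d x 1))"
  proof (cases "?a + ?b = 0")
    case True
    then have "?a = 0" "?b = 0" by (simp_all add: add_nonneg_eq_0_iff)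
    then show ?thesis by (simp add: UNIV_bit overlap_def)
  next
    case False
    have "(p 0 * ?a + (1 - p 0) * ?b) * ?a * d x 0 + (p 0 * ?a + (1 - p 0) * ?b) * ?b * d x 1 =
      (p 0 * ?a * d x 0 + (1 - p 0) * ?b * d x 1) * (?a + ?b) +
      (1 - p 0 - p 0) * (?a * ?b * (d x 0 - d x 1))"
      by (simp add: algebra_simps)
    then show ?thesis
      using False by (simp add: UNIV_bit P q overlap_def divide_simps)
  qed
qed

text \<open>The involution preserves \<open>overlap\<close> and negates the log ratio. This makes
  the first-order change of the mutual information vanish in
  \<open>posterior_distortion_le\<close>.\<close>

lemma (in symmetric_setting) sum_overlap_log_ratio:
  "(\<Sum>x\<in>UNIV. overlap W x * (ln (pmf (W 0) x) - ln (pmf (W 1) x))) = 0" (is "?S = 0")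
proof -
  have s: "pmf (W 1) (\<pi> x) = pmf (W 0) x" "pmf (W 0) (\<pi> x) = pmf (W 1) x" for x
    using sym[of 0 x] sym[of 1 x] by simp_all
  have "?S = (\<Sum>x\<in>UNIV. overlap W (\<pi> x) * (ln (pmf (W 0) (\<pi> x)) - ln (pmf (W 1) (\<pi> x))))"
    by (rule sum.reindex_bij_witness[of _ \<pi> \<pi>]) (simp_all add: inv)
  also have "\<dots> = - ?S"
    unfolding sum_negf[symmetric] overlap_def s by (intro sum.cong) (auto simp: algebra_simps diff_divide_distrib)
  finally show ?thesis by simp
qed

text \<open>If \<open>T > 0\<close>, moving \<open>P\<close> by \<open>t\<close> along \<open>N\<close> lowers the distortion by \<open>t T\<close> and changes the mutual
  information only to order \<open>t\<^sup>2\<close>, by symmetry of the channel. Mixing with the product of the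
  marginals at rate \<open>r = t T / 2\<close> then lowers the mutual information to first order, within the
  distortion gained.\<close>

lemma (in symmetric_setting) posterior_distortion_le:
  fixes P :: "('x \<times> bit) pmf"
  assumes d: "\<And>x z. 0 \<le> d x z \<and> d x z \<le> 1"
    and opt: "optimal_joint P\<^sub>X d dbar P" and ind: "induced_channel P W"
    and dependent: "mutual_info P \<noteq> 0"
  shows "posterior_distortion W P\<^sub>X d \<le> dbar"
proof (rule ccontr)
  assume contr: "\<not> posterior_distortion W P\<^sub>X d \<le> dbar"
  define p where "p = pmf (map_pmf snd P)"
  define c where "c = p 1 - p 0"
  define T where "T = c * (\<Sum>x\<in>UNIV. overlap W x * (d x 0 - d x 1))"
  define Ed where "Ed = (\<Sum>x\<in>UNIV. \<Sum>z\<in>UNIV. p z * pmf (W z) x * d x z)"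
  have PW: "pmf P (x, z) = p z * pmf (W z) x" for x z
    using ind by (simp add: induced_channel_def p_def)
  have fst_P: "map_pmf fst P = P\<^sub>X"
    using opt by (simp add: optimal_joint_def admissible_joint_def)
  have PX: "pmf P\<^sub>X x = p 0 * pmf (W 0) x + p 1 * pmf (W 1) x" for x
    unfolding fst_P[symmetric] pmf_map_fst by (simp add: UNIV_bit PW)
  have p_nonneg: "0 \<le> p z" for z by (simp add: p_def)
  have "(\<Sum>z\<in>UNIV. p z) = 1"
    unfolding p_def by (rule sum_pmf_eq_1) auto
  then have p_sum: "p 0 + p 1 = 1"
    by (simp add: UNIV_bit)
  have Ed_le: "Ed \<le> dbar"
    using opt unfolding optimal_joint_def admissible_joint_def
    by (simp add: expectation_finite Ed_def sum.cartesian_product case_prod_beta PW[symmetric])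
  have "posterior_distortion W P\<^sub>X d = Ed + T"
    unfolding Ed_def T_def c_def by (rule posterior_distortion_eq[OF PX p_sum])
  then have T: "T > 0"
    using contr Ed_le by simp
  \<comment> \<open>A vanishing input probability would make \<open>P\<close> a product, with mutual
    information zero.\<close>
  have p_pos: "p z > 0" for z
  proof (rule ccontr)
    assume "\<not> p z > 0"
    then have pz: "p z = 0" "p (z + 1) = 1"
      using p_nonneg[of z] p_sum by (cases z; simp)+
    have "kl (pmf P) (\<lambda>a. pmf P\<^sub>X (fst a) * p (snd a)) = 0"
      unfolding kl_def
    proof (intro sum.neutral ballI)
      fix a :: "'x \<times> bit"
      obtain x y where a: "a = (x, y)" by (cases a)
      have "pmf P\<^sub>X x = pmf (W (z + 1)) x"
        using pz by (cases z) (simp_all add: PX)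
      then show "pmf P a * ln (pmf P a / (pmf P\<^sub>X (fst a) * p (snd a))) = 0"
        using pz by (cases y; cases z) (auto simp: a PW)
    qed
    then show False
      using dependent mutual_info_eq_kl[of P] by (simp add: fst_P p_def)
  qed
  have c: "\<bar>c\<bar> \<le> 1"
    using p_nonneg[of 0] p_nonneg[of 1] p_sum by (simp add: c_def)
  define R where "R = (\<lambda>a. pmf P\<^sub>X (fst a) * p (snd a))"
  define I where "I = kl (pmf P) R"
  have I_eq: "I = ln 2 * mutual_info P"
    using mutual_info_eq_kl[of P] by (simp add: I_def R_def fst_P p_def)
  then have I: "I > 0"
    using dependent mutual_info_nonneg[of P] by (simp add: less_le)
  \<comment> \<open>The difference \<open>P - N\<close> is the joint distribution of a source letter
    and its posterior sample, whose distortion exceeds that of \<open>P\<close> by \<open>T\<close>;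
    moving along \<open>N\<close> leads away from it.\<close>
  define N where "N = (\<lambda>a :: 'x \<times> bit. - c * bsign (snd a) * overlap W (fst a))"
  define K where "K = (\<Sum>a\<in>UNIV. (N a)\<^sup>2 / pmf P a)"
  have K: "K \<ge> 0"
    unfolding K_def by (intro sum_nonneg) auto
  \<comment> \<open>The bounds by \<open>p z\<close> keep \<open>P + t N\<close> nonnegative,
    \<open>1 / T\<close> ensures \<open>t * T \<le> 1\<close>, and the last one makes the quadratic
    cost \<open>t\<^sup>2 * K\<close> smaller than \<open>r * I\<close>. The summand in
    \<open>K + 1\<close> avoids division by zero.\<close>
  define t where "t = min (min (p 0) (p 1)) (min (1 / T) (T * I / (4 * (K + 1))))"
  define r where "r = t * T / 2"
  have t: "t > 0" "t \<le> p z" "t \<le> 1 / T" "t \<le> T * I / (4 * (K + 1))" for z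
    using p_pos T I K unfolding t_def by (cases z; auto)+
  have tT: "t * T \<le> 1"
    using t(3) T by (simp add: field_simps)
  have r: "0 < r" "r \<le> 1"
    using t(1) T tT by (simp_all add: r_def)
  have N_le: "t * \<bar>N (x, z)\<bar> \<le> pmf P (x, z)" for x z
  proof -
    have "\<bar>N (x, z)\<bar> \<le> pmf (W z) x"
      using mult_mono[OF c overlap_le[of W x z]] overlap_nonneg[of W x]
      by (cases z) (auto simp: N_def abs_mult)
    then show ?thesis
      unfolding PW using t(1) t(2)[of z] by (intro mult_mono) auto
  qed
  have U: "0 \<le> pmf P a + t * N a" for a
    using N_le[of "fst a" "snd a"] t(1) by (simp add: abs_if split: if_splits)
  have N0: "N a = 0" if "pmf P a = 0" for a
    using N_le[of "fst a" "snd a"] t(1) that by (simp add: mult_le_0_iff)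
  have R_nonneg: "0 \<le> R a" for a
    using p_nonneg by (simp add: R_def)
  have R_pos: "0 < R a" if "0 < pmf P a" for a
  proof -
    have "pmf P a \<le> pmf P\<^sub>X (fst a)"
      using p_nonneg[of 0] p_nonneg[of 1] by (cases a; cases "snd a") (auto simp: PX PW)
    then show ?thesis using that p_pos by (simp add: R_def)
  qed
  have sum_pair: "(\<Sum>a\<in>UNIV. f a) = (\<Sum>x\<in>UNIV. f (x, 0) + f (x, 1))" for f :: "'x \<times> bit \<Rightarrow> real"
  proof -
    have "(\<Sum>a\<in>UNIV. f a) = (\<Sum>x\<in>UNIV. \<Sum>z\<in>UNIV. f (x, z))"
      by (simp add: sum.cartesian_product)
    then show ?thesis by (simp add: UNIV_bit)
  qed
  have sum_N: "(\<Sum>a\<in>UNIV. t * N a) = 0"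
    by (simp add: sum_pair N_def)
  \<comment> \<open>Where \<open>overlap W x\<close> is positive, \<open>pmf P / R\<close> is the
    likelihood over \<open>pmf P\<^sub>X x\<close>. The denominator drops out because
    \<open>N\<close> sums to zero over the two inputs.\<close>
  have flat: "(\<Sum>a\<in>UNIV. t * N a * ln (pmf P a / R a)) = 0"
  proof -
    have "t * N (x, 0) * ln (pmf P (x, 0) / R (x, 0)) + t * N (x, 1) * ln (pmf P (x, 1) / R (x, 1)) =
      - t * c * (overlap W x * (ln (pmf (W 0) x) - ln (pmf (W 1) x)))" for x
    proof (cases "overlap W x = 0")
      case False
      then have W: "pmf (W z) x > 0" for z
        using overlap_le[of W x z] overlap_nonneg[of W x] by linarith
      then have PXx: "pmf P\<^sub>X x > 0"
        unfolding PX using p_pos by (simp add: add_pos_pos)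
      have L: "ln (pmf P (x, z) / R (x, z)) = ln (pmf (W z) x) - ln (pmf P\<^sub>X x)" for z
        using W[of z] PXx p_pos[of z] by (simp add: PW R_def ln_div)
      show ?thesis
        unfolding L by (simp add: N_def algebra_simps)
    qed (simp add: N_def)
    then show ?thesis
      by (simp add: sum_pair sum_negf sum_distrib_left[symmetric] sum_overlap_log_ratio)
  qed
  let ?f = "\<lambda>a. (1 - r) * (pmf P a + t * N a) + r * R a"
  have sum_R: "(\<Sum>a\<in>UNIV. R a) = 1"
    unfolding sum_pair R_def by (simp add: distrib_left[symmetric] p_sum sum_pmf_eq_1)
  have f_nonneg: "0 \<le> ?f a" for a
    using mult_nonneg_nonneg[OF _ U[of a], of "1 - r"] mult_nonneg_nonneg[OF _ R_nonneg[of a], of r] r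
    by simp
  have sum_f: "(\<Sum>a\<in>UNIV. ?f a) = 1"
    unfolding sum.distrib sum_distrib_left[symmetric, of "1 - r"] sum_distrib_left[symmetric, of r]
      sum_N sum_R by (simp add: sum_pmf_eq_1)
  obtain P' where P': "\<And>a. pmf P' a = ?f a"
    using ex_pmf_of_fun[of ?f, OF f_nonneg sum_f] by blast
  have fst_P': "map_pmf fst P' = P\<^sub>X"
  proof (rule pmf_eqI)
    fix x
    have "pmf (map_pmf fst P') x = ?f (x, 0) + ?f (x, 1)"
      by (simp add: pmf_map_fst UNIV_bit P')
    also have "\<dots> = (1 - r) * pmf P\<^sub>X x + r * (pmf P\<^sub>X x * (p 0 + p 1))"
      by (simp add: PW PX N_def R_def algebra_simps)
    finally show "pmf (map_pmf fst P') x = pmf P\<^sub>X x"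
      unfolding p_sum by (simp add: algebra_simps)
  qed
  define ER where "ER = (\<Sum>a\<in>UNIV. R a * d (fst a) (snd a))"
  have ER: "ER \<le> 1"
    unfolding ER_def sum_R[symmetric] using R_nonneg d by (intro sum_mono mult_left_le) auto
  have EdP: "Ed = (\<Sum>a\<in>UNIV. pmf P a * d (fst a) (snd a))"
    unfolding Ed_def sum_pair by (simp add: UNIV_bit PW)
  have Ed0: "0 \<le> Ed"
    unfolding EdP using d by (intro sum_nonneg) auto
  have TN: "(\<Sum>a\<in>UNIV. N a * d (fst a) (snd a)) = - T"
    unfolding T_def sum_pair N_def sum_distrib_left sum_negf[symmetric]
    by (intro sum.cong) (auto simp: algebra_simps)
  have "(\<Sum>a\<in>UNIV. ?f a * d (fst a) (snd a)) = (1 - r) * (Ed + t * (- T)) + r * ER"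
    unfolding EdP ER_def TN[symmetric] sum_distrib_left sum.distrib[symmetric]
    by (intro sum.cong) (auto simp: algebra_simps)
  also have "\<dots> \<le> (1 - r) * (Ed + t * (- T)) + r * 1"
    using ER r by (intro add_left_mono mult_left_mono) auto
  \<comment> \<open>As \<open>t * T = 2 * r\<close>, the gain \<open>2 * r * (1 - r)\<close> pays
    for the distortion of the product of the marginals, at most \<open>r\<close>, up to
    \<open>r * (1 - 2 * r)\<close> to spare.\<close>
  also have "\<dots> = Ed - r * Ed - r * (1 - t * T)"
    by (simp add: r_def field_simps)
  also have "\<dots> \<le> Ed"
  proof -
    have "0 \<le> r * Ed" "0 \<le> r * (1 - t * T)"
      using r Ed0 tT by auto
    then show ?thesis by linarith
  qed
  finally have "(\<Sum>a\<in>UNIV. ?f a * d (fst a) (snd a)) \<le> dbar"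
    using Ed_le by simp
  then have "admissible_joint P\<^sub>X d dbar P'"
    by (simp add: admissible_joint_def fst_P' expectation_finite P' case_prod_beta)
  then have "I \<le> ln 2 * mutual_info P'"
    using optimal_joint_le[OF opt] by (simp add: I_eq)
  \<comment> \<open>The second marginal of \<open>P'\<close> may differ from \<open>p\<close>;
    keeping \<open>R\<close> as reference still bounds the mutual information from above.\<close>
  also have "\<dots> \<le> kl (pmf P') R"
    using mutual_info_le_kl[of p P'] p_pos p_sum by (simp add: fst_P' R_def UNIV_bit)
  also have "\<dots> = kl ?f R"
    using P' by (simp add: kl_def)
  also have "\<dots> \<le> (1 - r) * kl (\<lambda>a. pmf P a + t * N a) R"
  proof (rule kl_mix_le[OF U R_nonneg _ r])
    fix a assume "0 < pmf P a + t * N a"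
    then show "0 < R a"
      using R_pos[of a] N0[of a] by (cases "pmf P a = 0") (auto simp: less_le)
  qed
  also have "\<dots> \<le> (1 - r) * (I + (\<Sum>a\<in>UNIV. (t * N a)\<^sup>2 / pmf P a))"
    unfolding I_def using r N0
    by (intro mult_left_mono kl_perturb_le U R_pos sum_N flat) auto
  also have "(\<Sum>a\<in>UNIV. (t * N a)\<^sup>2 / pmf P a) = t\<^sup>2 * K"
    unfolding K_def sum_distrib_left by (simp add: power_mult_distrib)
  also have "(1 - r) * (I + t\<^sup>2 * K) \<le> (1 - r) * I + t\<^sup>2 * K"
    using r K by (simp add: algebra_simps)
  also have "t\<^sup>2 * K < r * I"
  proof -
    have "4 * (t * K) + 4 * t \<le> T * I"
      using t(4) K by (simp add: field_simps)
    moreover have "0 \<le> t * K"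
      using t(1) K by simp
    ultimately have "t * K < T * I / 2"
      using t(1) by linarith
    then have "t * (t * K) < t * (T * I / 2)"
      using t(1) by (intro mult_strict_left_mono)
    then show ?thesis
      by (simp add: r_def power2_eq_square mult_ac)
  qed
  finally show False
    by (simp add: algebra_simps)
qed

text \<open>The single-letter formula with \<open>unit\<close> as second alphabet, which admits only
  one reconstruction word.\<close>

lemma sum_iid_source_constant:
  fixes P\<^sub>X :: "'x::finite pmf" and d :: "'x \<Rightarrow> 'y \<Rightarrow> real"
  shows "(\<Sum>x\<in>UNIV. pmf (iid_source P\<^sub>X) x * symbolwise_distortion d (x :: 'n::finite \<Rightarrow> 'x) (\<lambda>_. y)) =
    (\<Sum>x\<in>UNIV. pmf P\<^sub>X x * d x y)"
proof -
  have "(\<Sum>x\<in>UNIV. \<Sum>u\<in>(UNIV :: unit set). pmf P\<^sub>X x) = 1"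
    by (simp add: sum_pmf_eq_1)
  from sum_product_symbolwise_distortion[OF this, of "\<lambda>x _. d x y", where 'n='n]
  show ?thesis
    by (simp add: pmf_iid_source symbolwise_distortion_def card_fun)
qed

section \<open>From a good coset to the compression scheme\<close>

theorem corollary2:
  fixes P\<^sub>X :: "'x::finite pmf"
    and dsym :: "'x \<Rightarrow> bit \<Rightarrow> real"
    and dbar k \<epsilon> :: real
    and P :: "('x \<times> bit) pmf"
    and W :: "bit \<Rightarrow> 'x pmf"
    and V :: "bit \<Rightarrow> complex ^ (bit \<times> 'd::finite) ^ (bit \<times> 'd)"
    and C :: "(bit ^ 'n::finite) set"
  assumes "\<And>x x'. 0 \<le> dsym x x' \<and> dsym x x' \<le> 1"
    and "dbar \<le> 1"
    and "optimal_joint P\<^sub>X dsym dbar P"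
    and "induced_channel P W"
    and "symmetric_channel W"
    and "dual_channel W V"
    and "linear_code V k \<epsilon> C"
  shows "\<exists>(M :: nat set) (E :: ('n \<Rightarrow> 'x) \<Rightarrow> nat) (D :: nat \<Rightarrow> ('n \<Rightarrow> bit)).
           lossy_compression_scheme (iid_source P\<^sub>X) (symbolwise_distortion dsym)
             (real CARD('n) - k) (dbar + sqrt (2 * \<epsilon>)) M E D"
proof -
  note d = assms(1)
  obtain \<pi> where \<pi>: "\<pi> \<circ> \<pi> = id" "\<forall>x x'. pmf (W (x' + 1)) (\<pi> x) = pmf (W x') x"
    using assms(5) unfolding symmetric_channel_def by blast
  interpret symmetric_setting W \<pi>
    using \<pi> by unfold_locales (auto dest: fun_cong[where f="\<pi> \<circ> \<pi>"])
  obtain \<Lambda> where C: "vec.subspace C" "log 2 (card C) = k" "povm C \<Lambda>" "avg_error V C \<Lambda> = \<epsilon>"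
    using assms(7) unfolding linear_code_def optimal_decoder_def by blast
  note code = assms(6) C(1,3)
  have \<epsilon>: "0 \<le> \<epsilon>"
    using sum_coset_deficit_le(2)[OF code] C(4) by simp
  define p where "p = pmf (map_pmf snd P)"
  have PW: "pmf P (x, z) = p z * pmf (W z) x" for x z
    using assms(4) by (simp add: induced_channel_def p_def)
  have adm: "map_pmf fst P = P\<^sub>X" "(\<Sum>x\<in>UNIV. \<Sum>z\<in>UNIV. pmf P (x, z) * dsym x z) \<le> dbar"
    using assms(3) unfolding optimal_joint_def admissible_joint_def
    by (simp_all add: expectation_finite sum.cartesian_product case_prod_beta)
  have "(\<Sum>z\<in>UNIV. p z) = 1"
    unfolding p_def by (rule sum_pmf_eq_1) auto
  then have p_sum: "p 0 + p 1 = 1"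
    by (simp add: UNIV_bit)
  have "\<exists>t. (\<Sum>x\<in>UNIV. pmf (iid_source P\<^sub>X) x * Min (symbolwise_distortion dsym x ` dual_coset C t)) \<le>
    dbar + sqrt (2 * \<epsilon>)"
  proof (cases "mutual_info P = 0")
    \<comment> \<open>Optimality does not control \<open>posterior_distortion\<close> here, but a constant reconstruction suffices,
      and it lies in some coset.\<close>
    case True
    then have "pmf P (x, z) = pmf P\<^sub>X x * p z" for x z
      using mutual_info_eq_0D[of P x z] by (simp add: adm(1) p_def)
    then have avg: "p 0 * (\<Sum>x\<in>UNIV. pmf P\<^sub>X x * dsym x 0) + p 1 * (\<Sum>x\<in>UNIV. pmf P\<^sub>X x * dsym x 1) \<le> dbar"
      using adm(2) by (simp add: UNIV_bit sum_distrib_left sum.distrib mult_ac)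
    let ?D = "\<lambda>z. \<Sum>x\<in>UNIV. pmf P\<^sub>X x * dsym x z"
    have "\<exists>z. ?D z \<le> dbar"
    proof (rule ccontr)
      assume "\<nexists>z. ?D z \<le> dbar"
      \<comment> \<open>Negation turns the lower bounds into the strict upper bounds that
        \<open>convex_bound_lt\<close> combines.\<close>
      then have "- ?D 0 < - dbar" "- ?D 1 < - dbar"
        by (simp_all add: not_le)
      then have "p 0 * - ?D 0 + p 1 * - ?D 1 < - dbar"
        using p_sum by (intro convex_bound_lt) (auto simp: p_def)
      then show False using avg by simp
    qed
    then obtain z where z: "(\<Sum>x\<in>UNIV. pmf P\<^sub>X x * dsym x z) \<le> dbar"
      by blast
    have "(\<Sum>x\<in>UNIV. pmf (iid_source P\<^sub>X) x * Min (symbolwise_distortion dsym x ` dual_coset C (\<lambda>_. z))) \<le>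
      (\<Sum>x\<in>UNIV. pmf (iid_source P\<^sub>X) x * symbolwise_distortion dsym x (\<lambda>_ :: 'n. z))"
      by (intro sum_mono mult_left_mono Min_le) auto
    also have "\<dots> \<le> dbar + sqrt (2 * \<epsilon>)"
      unfolding sum_iid_source_constant using z \<epsilon> by (simp add: add_increasing2)
    finally show ?thesis by blast
  next
    case False
    have PX: "pmf P\<^sub>X x = p 0 * pmf (W 0) x + p 1 * pmf (W 1) x" for x
      unfolding adm(1)[symmetric] pmf_map_fst by (simp add: UNIV_bit PW)
    have "posterior_distortion W P\<^sub>X dsym \<le> dbar"
      by (rule posterior_distortion_le[OF d assms(3,4) False])
    \<comment> \<open>The averaging argument yields the excess \<open>sqrt \<epsilon>\<close>, which
      is within the claimed one.\<close>
    moreover have "sqrt \<epsilon> \<le> sqrt (2 * \<epsilon>)"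
      using \<epsilon> by simp
    ultimately show ?thesis
      using exists_good_coset[OF d PX p_sum code] unfolding C(4) by (meson add_mono order_trans)
  qed
  then obtain t where "(\<Sum>x\<in>UNIV. pmf (iid_source P\<^sub>X) x *
      Min (symbolwise_distortion dsym x ` dual_coset C t)) \<le> dbar + sqrt (2 * \<epsilon>)"
    by blast
  from scheme_of_finite_codebook[OF _ _ this] show ?thesis
    by (simp add: log_card_dual_coset[OF C(1)] C(2))
qed

end
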